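(* Let $1\le\ell_1\le k_1$ and $1\le \ell_2\le k_2$ be integers, let $0<p<1$, $q=1-p$, and put $a(p)=q^{\ell_1}p^{\ell_2}$, $\ell=\ell_1+\ell_2$, $m_1=k_1-\ell_1+1$, $m_2=k_2-\ell_2+1$. Let $\rho_r$ be the waiting time, in a sequence of independent Bernoulli($p$) trials, for the $r$-th occurrence of the pattern "at least $\ell_1$ and at most $k_1$ consecutive 0's followed by at least $\ell_2$ and at most $k_2$ consecutive 1's". Let $H_r(t)=E[t^{\rho_r}]$, $g_r(m)=P(\rho_r=m)$ and $\tilde\mu_{r,j}=E[\rho_r^{\,j}]$. Let $\delta_{i,j}$ be the Kronecker delta and $\mathbf 1(\cdot)$ the indicator. Then: (i) For $r\ge1$ and $|t|\le1$, $\displaystyle H_r(t)=\frac{qt}{1-pt}\left(\frac{a(p)t^\ell(1-(qt)^{m_1})(1-(pt)^{m_2})}{1-t+a(p)t^\ell(1-(qt)^{m_1})(1-(pt)^{m_2})}\right)^r.$ (ii) For $r\ge2$ and $m\ge\ell r+1$, $$\begin{aligned}g_r(m)&=g_r(m-1)+a(p)\Big[g_{r-1}(m-\ell)-g_r(m-\ell)-q^{m_1}\big(g_{r-1}(m-\ell-m_1)-g_r(m-\ell-m_1)\big)\\&\quad-p^{m_2}\big(g_{r-1}(m-\ell-m_2)-g_r(m-\ell-m_2)\big)+q^{m_1}p^{m_2}\big(g_{r-1}(m-\ell-m_1-m_2)-g_r(m-\ell-m_1-m_2)\big)\Big],\end{aligned}$$ and for $m\ge \ell+1$, $$\begin{aligned}g_1(m)&=g_1(m-1)+q\,a(p)\,p^{m-\ell-1}\left(\mathbf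 1(\ell+1\le m\le \ell+m_2)-\left(\tfrac qp\right)^{m_1}\mathbf 1(\ell+m_1+1\le m\le \ell+m_1+m_2)\right)\\&\quad-a(p)\left[g_1(m-\ell)-q^{m_1}g_1(m-\ell-m_1)-p^{m_2}g_1(m-\ell-m_2)+q^{m_1}p^{m_2}g_1(m-\ell-m_1-m_2)\right],\end{aligned}$$ with initial conditions $g_0(m)=\delta_{m,0}$ and $g_r(m)=0$ whenever $m\le\ell r$ and $r\ge1$. (iii) For $j\ge1$ and $r\ge2$, $$\begin{aligned}\tilde\mu_{r,j}=\sum_{k=0}^{j}\binom jk\Big[\tilde\mu_{r,k}+a(p)\Big(&\ell^{j-k}-q^{m_1}(\ell+m_1)^{j-k}-p^{m_2}(\ell+m_2)^{j-k}\\&+q^{m_1}p^{m_2}(\ell+m_1+m_2)^{j-k}\Big)(\tilde\mu_{r-1,k}-\tilde\mu_{r,k})\Big],\end{aligned}$$ with initial conditions $\tilde\mu_{0,i}=\delta_{i,0}$ and, for $j\ge1$, $$\begin{aligned}\tilde\mu_{1,j}&=\sum_{k=0}^{j}\binom jk\tilde\mu_{1,k}\left[1-a(p)\left(\ell^{j-k}-q^{m_1}(\ell+m_1)^{j-k}-p^{m_2}(\ell+m_2)^{j-k}+q^{m_1}p^{m_2}(\ell+m_1+m_2)^{j-k}\right)\right]\\&\quad+q\,a(p)\left[\sum_{k=\ell+1}^{\ell+m_2}k^jp^{k-\ell-1}-\left(\tfrac qp\right)^{m_1}\sum_{k=\ell+m_1+1}^{\ell+m_1+m_2}k^jp^{k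-\ell-1}\right].\end{aligned}$$
   Context: Let $\zeta_1,\zeta_2,\dots$ be independent with $P(\zeta_i=1)=p$ and $P(\zeta_i=0)=q=1-p$. $H^n_{\ell_1,k_1,\ell_2,k_2}$ is the number of occurrences of the following pattern within $\zeta_1,\dots,\zeta_n$: a maximal block of consecutive 0's (i.e. one starting at position 1 or immediately preceded by a 1, and ended by a 1) of length $j$ with $\ell_1\le j\le k_1$, immediately followed by exactly $i$ consecutive 1's for some $\ell_2\le i\le k_2$, immediately followed by a 0, where this terminating 0 is at a position $\le n$. (The pattern is counted only when the terminating 0 occurs, so a final block of 1's not yet ended by a 0 within the first $n$ trials is not counted; the terminating 0 may be the first 0 of the next pattern.) For example, for the sequence 00111101100010100011 of length 20, $H^{20}_{1,1,1,1}=1$, $H^{20}_{1,2,2,2}=1$, $H^{20}_{1,1,1,2}=2$, $H^{20}_{1,2,1,2}=2$. The $r$-th waiting time is $\rho_r=\min\{n\ge0: H^n_{\ell_1,k_1,\ell_2,k_2}=r\}$, with $\rho_0=0$. $g_r(m)$ is defined for all integers $m$ (zero for negative $m$). *)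

theory Defs
  imports "HOL-Probability.Probability"
begin

text \<open>
  Trials are indexed from 1; the value of a sequence at 0 is never inspected.
  An occurrence is a triple (s, j, i): a maximal block of j zeros starts at position s, it is
  followed by exactly i ones, and the zero at position s + j + i that ends the run of ones
  belongs to the first n trials.
\<close>

definition pattern_occurrences ::
    "nat \<Rightarrow> nat \<Rightarrow> nat \<Rightarrow> nat \<Rightarrow> nat \<Rightarrow> (nat \<Rightarrow> nat) \<Rightarrow> (nat \<times> nat \<times> nat) set" where
  "pattern_occurrences l1 k1 l2 k2 n x =
     {(s, j, i). 1 \<le> s \<and> (s = 1 \<or> x (s - 1) = 1) \<and>
        l1 \<le> j \<and> j \<le> k1 \<and> (\<forall>u\<in>{s..<s + j}. x u = 0) \<and>
        l2 \<le> i \<and> i \<le> k2 \<and> (\<forall>u\<in>{s + j..<s + j + i}. x u = 1) \<and>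
        x (s + j + i) = 0 \<and> s + j + i \<le> n}"

definition pattern_count ::
    "nat \<Rightarrow> nat \<Rightarrow> nat \<Rightarrow> nat \<Rightarrow> nat \<Rightarrow> (nat \<Rightarrow> nat) \<Rightarrow> nat" where
  "pattern_count l1 k1 l2 k2 n x = card (pattern_occurrences l1 k1 l2 k2 n x)"

text \<open>The infimum of the empty set is \<open>\<infinity>\<close>: the r-th occurrence never happens.\<close>

definition waiting_time ::
    "nat \<Rightarrow> nat \<Rightarrow> nat \<Rightarrow> nat \<Rightarrow> nat \<Rightarrow> (nat \<Rightarrow> nat) \<Rightarrow> enat" where
  "waiting_time l1 k1 l2 k2 r x = (INF n\<in>{n. pattern_count l1 k1 l2 k2 n x = r}. enat n)"

text \<open>
  The convention \<open>t\<^sup>\<infinity> = 0\<close>, also for \<open>\<bar>t\<bar> = 1\<close>, makes the value at \<open>t = 1\<close> of the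
  probability generating function of \<open>X\<close> equal to the probability that \<open>X\<close> is finite.
\<close>

definition enat_pow :: "complex \<Rightarrow> enat \<Rightarrow> complex" where
  "enat_pow t e = (case e of enat n \<Rightarrow> t ^ n | \<infinity> \<Rightarrow> 0)"

definition pgf :: "'a measure \<Rightarrow> ('a \<Rightarrow> enat) \<Rightarrow> complex \<Rightarrow> complex" where
  "pgf M X t = (LINT \<omega>|M. enat_pow t (X \<omega>))"

definition point_prob :: "'a measure \<Rightarrow> ('a \<Rightarrow> enat) \<Rightarrow> int \<Rightarrow> real" where
  "point_prob M X m = measure M {\<omega> \<in> space M. 0 \<le> m \<and> X \<omega> = enat (nat m)}"

definition moment :: "'a measure \<Rightarrow> ('a \<Rightarrow> enat) \<Rightarrow> nat \<Rightarrow> ennreal" where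
  "moment M X j = (\<integral>\<^sup>+ \<omega>. ennreal_of_enat (X \<omega>) ^ j \<partial>M)"

end

theory Submission
  imports Defs "HOL-Complex_Analysis.Cauchy_Integral_Formula"
begin

text \<open>
  Call a cycle a maximal block of zeros, the block of ones after it, and the zero that ends the
  latter. The starts of zero blocks are renewal times, and a cycle with \<open>j\<close> zeros and \<open>i\<close> ones has
  probability \<open>q ^ j * p ^ i\<close> given that a zero block starts. Let \<open>f r n\<close> be the probability that
  a zero block starts at time \<open>n\<close> with exactly \<open>r\<close> occurrences so far, and \<open>g r n\<close> the probability
  that the waiting time is \<open>n\<close>. Splitting off the last cycle gives convolution equations for \<open>f\<close>
  and \<open>g\<close>; as power series, after clearing the geometric denominators and with \<open>N\<close> for the
  numerator \<open>a X ^ l (1 - (q X) ^ m1) (1 - (p X) ^ m2)\<close>, they become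
  \<open>(1 - X + N) G (r + 1) = N G r\<close>, with a similar equation for \<open>G 1\<close>. Comparing coefficients
  gives the recurrences, evaluating at \<open>norm t \<le> 1\<close> gives the generating functions, and pairing
  with \<open>n ^ j\<close> gives the moments. These are finite because \<open>1 - X + N\<close> has no zero in the closed
  unit disc, so that \<open>G r\<close> converges on a larger disc.
\<close>

section \<open>Cycles and the pattern count\<close>

text \<open>The lengths are only required to be positive and there is no horizon, so that after an
  initial run of ones a 0-1 path splits into consecutive cycles, whether or not they match the
  pattern.\<close>

definition cycle_at :: "nat \<Rightarrow> nat \<Rightarrow> nat \<Rightarrow> (nat \<Rightarrow> nat) \<Rightarrow> bool" where
  "cycle_at s j i x \<longleftrightarrow> 1 \<le> s \<and> (s = 1 \<or> x (s - 1) = 1) \<and> 1 \<le> j \<and> (\<forall>u\<in>{s..<s + j}. x u = 0) \<and>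
     1 \<le> i \<and> (\<forall>u\<in>{s + j..<s + j + i}. x u = 1) \<and> x (s + j + i) = 0"

definition zero_block_starts :: "nat \<Rightarrow> (nat \<Rightarrow> nat) \<Rightarrow> bool" where
  "zero_block_starts n x \<longleftrightarrow> 1 \<le> n \<and> x n = 0 \<and> (n = 1 \<or> x (n - 1) = 1)"

lemma cycle_at_zero: "cycle_at s j i x \<Longrightarrow> s \<le> u \<Longrightarrow> u < s + j \<Longrightarrow> x u = 0"
  unfolding cycle_at_def by simp

lemma cycle_at_one: "cycle_at s j i x \<Longrightarrow> s + j \<le> u \<Longrightarrow> u < s + j + i \<Longrightarrow> x u = 1"
  unfolding cycle_at_def by simp

text \<open>A cycle can be read backwards from its terminal zero: the run of ones reaches back to
  the previous zero, and the zero block is maximal. Hence the events given by different last cycles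
  are disjoint.\<close>

lemma cycle_at_unique:
  assumes "cycle_at s j i x" "cycle_at s' j' i' x" "s + j + i = s' + j' + i'"
  shows "s = s' \<and> j = j' \<and> i = i'"
proof -
  have no_shorter_ones: False
    if "cycle_at s j i x" "cycle_at s' j' i' x" "s + j + i = s' + j' + i'" "i < i'" for s j i s' j' i'
  proof -
    have "1 \<le> j" using that(1) by (simp add: cycle_at_def)
    \<comment> \<open>The position just before the shorter run of ones is a zero of one cycle and a
      one of the other.\<close>
    then have "x (s + j - 1) = 0" "x (s + j - 1) = 1"
      by (rule_tac cycle_at_zero[OF that(1)] cycle_at_one[OF that(2)]; use that(3,4) in linarith)+
    then show False by simp
  qed
  have i: "i = i'"
    using no_shorter_ones[OF assms] no_shorter_ones[OF assms(2,1) assms(3)[symmetric]]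
    by (meson linorder_neqE_nat)
  have no_shorter_zeros: False
    if "cycle_at s j i x" "cycle_at s' j' i' x" "s + j = s' + j'" "j < j'" for s j i s' j' i'
  proof -
    \<comment> \<open>The longer zero block covers the position before the shorter one, against the
      maximality of the latter.\<close>
    have "1 \<le> s'" "1 \<le> s" "s = 1 \<or> x (s - 1) = 1" using that(1,2) by (simp_all add: cycle_at_def)
    moreover from this have "x (s - 1) = 0"
      using that by (intro cycle_at_zero[OF that(2)]) auto
    ultimately show False using that(3,4) by auto
  qed
  have sj: "s + j = s' + j'" using assms(3) i by simp
  have "j = j'"
    using no_shorter_zeros[OF assms(1,2) sj] no_shorter_zeros[OF assms(2,1) sj[symmetric]]
    by (meson linorder_neqE_nat)
  with sj i show ?thesis by simp
qed

lemma zero_block_starts_after_cycle: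
  "cycle_at s j i x \<Longrightarrow> zero_block_starts (s + j + i) x"
  unfolding cycle_at_def zero_block_starts_def by (auto simp: Suc_le_eq)

lemma zero_block_starts_of_cycle: "cycle_at s j i x \<Longrightarrow> zero_block_starts s x"
  unfolding cycle_at_def zero_block_starts_def by auto

text \<open>Going back from \<open>n\<close>, let \<open>z\<close> be the last earlier zero.
  Everything between \<open>z\<close> and \<open>n\<close> is a one, and the zero block that ends at
  \<open>z\<close> is extended to the left as far as possible.\<close>

lemma last_cycle_exists:
  assumes bin: "\<And>u. 1 \<le> u \<Longrightarrow> x u = 0 \<or> x u = 1"
    and st: "zero_block_starts n x"
    and ones: "\<not> (\<forall>u\<in>{1..<n}. x u = 1)"
  shows "\<exists>s j i. cycle_at s j i x \<and> s + j + i = n"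
proof -
  let ?Z = "{u\<in>{1..<n}. x u = 0}"
  define z where "z = Max ?Z"
  have ne: "?Z \<noteq> {}" using ones bin by fastforce
  have zin: "z \<in> ?Z" unfolding z_def by (rule Max_in) (use ne in auto)
  have zmax: "u \<le> z" if "u \<in> ?Z" for u unfolding z_def by (rule Max_ge) (use that in auto)
  have after: "x u = 1" if "z < u" "u < n" for u
    using zmax[of u] bin[of u] that zin by fastforce
  \<comment> \<open>As \<open>n\<close> starts a zero block, position \<open>n - 1\<close> carries a
    one; so the run of ones is not empty.\<close>
  have zn: "z < n - 1"
  proof (rule ccontr)
    assume "\<not> ?thesis"
    with zin have "z = n - 1" "n \<noteq> 1" by auto
    with st zin show False by (auto simp: zero_block_starts_def)
  qed
  \<comment> \<open>The least start of an all-zero stretch reaching \<open>z\<close>; its minimality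
    is the maximality of the block on the left.\<close>
  let ?P = "\<lambda>s. 1 \<le> s \<and> s \<le> z \<and> (\<forall>u\<in>{s..z}. x u = 0)"
  define s where "s = (LEAST s. ?P s)"
  have "?P z" using zin by auto
  then have s: "?P s" unfolding s_def by (rule LeastI)
  have before: "s = 1 \<or> x (s - 1) = 1"
  proof (rule ccontr)
    assume A: "\<not> ?thesis"
    then have 0: "x (s - 1) = 0" using bin[of "s - 1"] s by auto
    have "?P (s - 1)"
    proof (intro conjI ballI)
      show "1 \<le> s - 1" "s - 1 \<le> z" using A s by auto
      fix u assume "u \<in> {s - 1..z}"
      then have "u = s - 1 \<or> u \<in> {s..z}" by auto
      then show "x u = 0" using 0 s by blast
    qed
    from Least_le[of ?P, OF this] have "s \<le> s - 1" by (fold s_def)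
    moreover have "1 \<le> s" using s by blast
    ultimately show False by linarith
  qed
  have "cycle_at s (z + 1 - s) (n - 1 - z) x"
    unfolding cycle_at_def
  proof (intro conjI ballI)
    show "1 \<le> s" "s = 1 \<or> x (s - 1) = 1" "1 \<le> z + 1 - s" "1 \<le> n - 1 - z"
      using s before zn by auto
    show "x u = 0" if "u \<in> {s..<s + (z + 1 - s)}" for u using that s by simp
    show "x u = 1" if "u \<in> {s + (z + 1 - s)..<s + (z + 1 - s) + (n - 1 - z)}" for u
      using that s zn by (intro after) auto
    have "s + (z + 1 - s) + (n - 1 - z) = n" using s zn by auto
    then show "x (s + (z + 1 - s) + (n - 1 - z)) = 0" using st by (simp add: zero_block_starts_def)
  qed
  moreover have "s + (z + 1 - s) + (n - 1 - z) = n" using s zn by auto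
  ultimately show ?thesis by blast
qed

section \<open>Counts and waiting times in terms of cycles\<close>

context
  fixes l1 k1 l2 k2 :: nat
  assumes l1: "1 \<le> l1" and l2: "1 \<le> l2"
begin

abbreviation good :: "nat \<Rightarrow> nat \<Rightarrow> bool" where
  "good j i \<equiv> l1 \<le> j \<and> j \<le> k1 \<and> l2 \<le> i \<and> i \<le> k2"

abbreviation occ :: "nat \<Rightarrow> (nat \<Rightarrow> nat) \<Rightarrow> (nat \<times> nat \<times> nat) set" where
  "occ \<equiv> pattern_occurrences l1 k1 l2 k2"

abbreviation cnt :: "nat \<Rightarrow> (nat \<Rightarrow> nat) \<Rightarrow> nat" where
  "cnt \<equiv> pattern_count l1 k1 l2 k2"

text \<open>As \<open>l1\<close> and \<open>l2\<close> are positive, the length windows already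
  imply the nonempty blocks that \<open>cycle_at\<close> asks for.\<close>

lemma pattern_occurrences_eq_cycles:
  "occ n x = {(s, j, i). cycle_at s j i x \<and> good j i \<and> s + j + i \<le> n}"
  unfolding pattern_occurrences_def cycle_at_def using l1 l2 by auto

lemma finite_pattern_occurrences: "finite (occ n x)"
  by (rule finite_subset[of _ "{..n} \<times> {..n} \<times> {..n}"])
    (auto simp: pattern_occurrences_def)

lemma pattern_occurrences_mono: "m \<le> n \<Longrightarrow> occ m x \<subseteq> occ n x"
  by (auto simp: pattern_occurrences_def)

text \<open>The count up to \<open>n\<close> inspects the first \<open>n\<close> trials only;
  measurability and independence of the past rest on this.\<close>

lemma pattern_count_cong:
  assumes "\<And>u. u \<in> {1..n} \<Longrightarrow> x u = y u"
  shows "cnt n x = cnt n y"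
proof -
  have "occ n x \<subseteq> occ n y" if "\<And>u. u \<in> {1..n} \<Longrightarrow> x u = y u" for x y
  proof (clarsimp simp: pattern_occurrences_def, intro conjI ballI)
    fix s j i u
    assume A: "Suc 0 \<le> s" "s + j + i \<le> n" "s = Suc 0 \<or> x (s - Suc 0) = Suc 0"
      "\<forall>u\<in>{s..<s + j}. x u = 0" "\<forall>u\<in>{s + j..<s + j + i}. x u = Suc 0" "x (s + j + i) = 0"
    show "s = Suc 0 \<or> y (s - Suc 0) = Suc 0"
    proof (cases "s = Suc 0")
      case False
      then have "s - Suc 0 \<in> {1..n}" using A by auto
      then show ?thesis using A that[of "s - Suc 0"] by simp
    qed simp
    show "y (s + j + i) = 0" using A that[of "s + j + i"] by simp
    show "y u = 0" if "u \<in> {s..<s + j}" using A that \<open>\<And>u. u \<in> {1..n} \<Longrightarrow> x u = y u\<close>[of u] by simp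
    show "y u = Suc 0" if "u \<in> {s + j..<s + j + i}"
      using A that \<open>\<And>u. u \<in> {1..n} \<Longrightarrow> x u = y u\<close>[of u] by simp
  qed
  from this[of x y] this[of y x] assms show ?thesis unfolding pattern_count_def by fastforce
qed

lemma pattern_count_zero [simp]: "cnt 0 x = 0"
proof -
  have "occ 0 x = {}" by (auto simp: pattern_occurrences_def)
  then show ?thesis by (simp add: pattern_count_def)
qed

lemma pattern_count_all_ones:
  assumes "\<forall>u\<in>{1..<n}. x u = 1"
  shows "cnt n x = 0"
proof -
  have "\<not> cycle_at s j i x" if "s + j + i \<le> n" for s j i
  proof
    assume C: "cycle_at s j i x"
    then have "x s = 0" "s \<in> {1..<n}" using that by (auto simp: cycle_at_def)
    with assms show False by force
  qed
  then have "occ n x = {}" unfolding pattern_occurrences_eq_cycles by auto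
  then show ?thesis by (simp add: pattern_count_def)
qed

text \<open>A cycle can end only at a zero preceded by a one. After \<open>s\<close> and up to the
  end of the given cycle, its terminal zero is the only such position.\<close>

lemma pattern_count_after_cycle:
  assumes C: "cycle_at s j i x"
  shows "cnt (s + j + i) x = cnt s x + of_bool (good j i)"
proof -
  let ?n = "s + j + i"
  have "t \<in> occ ?n x \<longleftrightarrow> t \<in> occ s x \<or> good j i \<and> t = (s, j, i)" for t
  proof
    assume "t \<in> occ ?n x"
    then obtain s' j' i' where t: "t = (s', j', i')" and C': "cycle_at s' j' i' x"
      and g: "good j' i'" and le: "s' + j' + i' \<le> ?n"
      unfolding pattern_occurrences_eq_cycles by auto
    show "t \<in> occ s x \<or> good j i \<and> t = (s, j, i)"
    proof (cases "s' + j' + i' \<le> s")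
      case True
      then show ?thesis using t C' g unfolding pattern_occurrences_eq_cycles by auto
    next
      case False
      let ?e = "s' + j' + i'"
      have e0: "x ?e = 0" using C' by (simp add: cycle_at_def)
      have "1 \<le> i'" using C' by (simp add: cycle_at_def)
      then have e1: "x (?e - 1) = 1" by (intro cycle_at_one[OF C']) auto
      \<comment> \<open>The predecessor of \<open>?e\<close> is a one, so \<open>?e\<close> is not
        among \<open>s + 1\<close> to \<open>s + j\<close>; being a zero itself, it is not in the
        run of ones either.\<close>
      have "?e - 1 \<notin> {s..<s + j}" using e1 cycle_at_zero[OF C] by force
      moreover have "?e \<notin> {s + j..<s + j + i}" using e0 cycle_at_one[OF C] by force
      moreover have "?e \<noteq> s + j"
        using \<open>?e - 1 \<notin> {s..<s + j}\<close> C by (auto simp: cycle_at_def)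
      ultimately have "?e = ?n" using False le by auto
      from cycle_at_unique[OF C' C this] show ?thesis using t g by auto
    qed
  next
    assume "t \<in> occ s x \<or> good j i \<and> t = (s, j, i)"
    then show "t \<in> occ ?n x"
      using C pattern_occurrences_mono[of s ?n x] unfolding pattern_occurrences_eq_cycles by auto
  qed
  then have eq: "occ ?n x = occ s x \<union> (if good j i then {(s, j, i)} else {})" by auto
  have "(s, j, i) \<notin> occ s x" using C by (auto simp: pattern_occurrences_def cycle_at_def)
  then show ?thesis
    unfolding pattern_count_def eq using finite_pattern_occurrences[of s x] by auto
qed

text \<open>The infimum of a nonempty set of naturals is its least element; for the empty set it is
  infinite and both sides are false.\<close>

lemma waiting_time_eq_enat_iff:
  "waiting_time l1 k1 l2 k2 r x = enat m \<longleftrightarrow> cnt m x = r \<and> (\<forall>n<m. cnt n x \<noteq> r)"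
proof -
  let ?S = "{n. cnt n x = r}"
  have least: "(INF n\<in>?S. enat n) = enat k" if "k \<in> ?S" "\<forall>n<k. n \<notin> ?S" for k
  proof (rule antisym)
    show "(INF n\<in>?S. enat n) \<le> enat k" by (rule INF_lower) (rule that(1))
    show "enat k \<le> (INF n\<in>?S. enat n)"
    proof (rule INF_greatest)
      fix n assume "n \<in> ?S"
      then show "enat k \<le> enat n" using that(2) by (meson enat_ord_simps(1) not_less)
    qed
  qed
  show ?thesis
  proof (cases "?S = {}")
    case True
    then show ?thesis unfolding waiting_time_def by (auto simp: top_enat_def)
  next
    case False
    define k where "k = (LEAST k. k \<in> ?S)"
    have k: "k \<in> ?S" unfolding k_def using False by (metis LeastI equals0I)
    have k': "\<forall>n<k. n \<notin> ?S" unfolding k_def using not_less_Least by blast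
    have "waiting_time l1 k1 l2 k2 r x = enat k"
      unfolding waiting_time_def by (rule least[OF k k'])
    then show ?thesis using k k' by (metis (lifting) enat.inject linorder_neqE_nat mem_Collect_eq)
  qed
qed

lemma waiting_time_zero: "waiting_time l1 k1 l2 k2 0 x = enat 0"
  unfolding waiting_time_eq_enat_iff by simp

text \<open>The count is monotone and moves only when a good cycle ends, then by exactly one. So the
  count first reaches \<open>Suc r\<close> at the end of a good cycle that began with count
  \<open>r\<close>.\<close>

lemma waiting_time_Suc_iff:
  "waiting_time l1 k1 l2 k2 (Suc r) x = enat m \<longleftrightarrow>
    (\<exists>s j i. s + j + i = m \<and> good j i \<and> cycle_at s j i x \<and> cnt s x = r)"
proof
  assume "waiting_time l1 k1 l2 k2 (Suc r) x = enat m"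
  then have c: "cnt m x = Suc r" and ne: "\<And>n. n < m \<Longrightarrow> cnt n x \<noteq> Suc r"
    unfolding waiting_time_eq_enat_iff by auto
  from c have m: "m \<noteq> 0" by (metis nat.distinct(1) pattern_count_zero)
  \<comment> \<open>By minimality of \<open>m\<close> the count jumps there, so some occurrence ends
    exactly at \<open>m\<close>.\<close>
  then have "cnt (m - 1) x \<noteq> cnt m x" using ne[of "m - 1"] c by auto
  then have "occ (m - 1) x \<noteq> occ m x" unfolding pattern_count_def by metis
  then obtain s j i where "(s, j, i) \<in> occ m x" "(s, j, i) \<notin> occ (m - 1) x"
    using pattern_occurrences_mono[of "m - 1" m x] by auto
  then have C: "cycle_at s j i x" and g: "good j i" and e: "s + j + i = m"
    unfolding pattern_occurrences_eq_cycles by auto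
  then show "\<exists>s j i. s + j + i = m \<and> good j i \<and> cycle_at s j i x \<and> cnt s x = r"
    using pattern_count_after_cycle[OF C] c by auto
next
  assume "\<exists>s j i. s + j + i = m \<and> good j i \<and> cycle_at s j i x \<and> cnt s x = r"
  then obtain s j i where e: "s + j + i = m" and g: "good j i" and C: "cycle_at s j i x"
    and c: "cnt s x = r" by blast
  have cm: "cnt m x = Suc r" using pattern_count_after_cycle[OF C] e g c by simp
  \<comment> \<open>The occurrence ending at \<open>m\<close> is missing before \<open>m\<close>,
    which makes \<open>m\<close> the first time with this count.\<close>
  have "cnt n x < cnt m x" if "n < m" for n
  proof -
    have "(s, j, i) \<in> occ m x" "(s, j, i) \<notin> occ n x"
      using C g e that unfolding pattern_occurrences_eq_cycles by auto
    then have "occ n x \<subset> occ m x" using pattern_occurrences_mono[of n m x] that by auto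
    then show ?thesis unfolding pattern_count_def
      by (intro psubset_card_mono finite_pattern_occurrences)
  qed
  then show "waiting_time l1 k1 l2 k2 (Suc r) x = enat m"
    unfolding waiting_time_eq_enat_iff using cm by fastforce
qed

end

section \<open>Independent trials\<close>

locale bernoulli_trials = prob_space +
  fixes \<zeta> :: "nat \<Rightarrow> 'a \<Rightarrow> nat" and p q :: real
  assumes indep: "indep_vars (\<lambda>_. count_space UNIV) \<zeta> {1..}"
    and prob_one: "\<And>i. 1 \<le> i \<Longrightarrow> prob {\<omega> \<in> space M. \<zeta> i \<omega> = 1} = p"
    and prob_zero: "\<And>i. 1 \<le> i \<Longrightarrow> prob {\<omega> \<in> space M. \<zeta> i \<omega> = 0} = q"
    and p_pos: "0 < p" and p_less_1: "p < 1" and q_eq: "q = 1 - p"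
begin

abbreviation path :: "'a \<Rightarrow> nat \<Rightarrow> nat" where
  "path \<omega> \<equiv> (\<lambda>i. \<zeta> i \<omega>)"

lemma measurable_trial: "1 \<le> i \<Longrightarrow> \<zeta> i \<in> measurable M (count_space UNIV)"
  using indep unfolding indep_vars_def by simp

text \<open>Stands in for adaptedness to the filtration of the trials: it yields both measurability
  of the event and its independence of trial \<open>Suc n\<close>.\<close>

definition determined_by :: "nat \<Rightarrow> ((nat \<Rightarrow> nat) \<Rightarrow> bool) \<Rightarrow> bool" where
  "determined_by n Q \<longleftrightarrow> (\<forall>x y. (\<forall>u\<in>{1..n}. x u = y u) \<longrightarrow> Q x = Q y)"

lemma determined_byD: "determined_by n Q \<Longrightarrow> (\<And>u. u \<in> {1..n} \<Longrightarrow> x u = y u) \<Longrightarrow> Q x = Q y"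
  unfolding determined_by_def by blast

lemma determined_by_mono: "determined_by m Q \<Longrightarrow> m \<le> n \<Longrightarrow> determined_by n Q"
  unfolding determined_by_def by (meson atLeastAtMost_iff le_trans)

lemma determined_by_conj:
  "determined_by n Q \<Longrightarrow> determined_by n R \<Longrightarrow> determined_by n (\<lambda>x. Q x \<and> R x)"
  unfolding determined_by_def by blast

text \<open>A finite product of countable discrete spaces is discrete, so every set of initial
  segments is measurable and predicates on paths carry no measurability condition.\<close>

lemma PiM_trials: "PiM {1..n} (\<lambda>_. count_space UNIV) = (count_space (PiE {1..n} (\<lambda>_. UNIV)) :: (nat \<Rightarrow> nat) measure)"
  by (rule count_space_PiM_finite) auto

lemma determined_by_vimage:
  assumes "determined_by n Q"
  shows "{\<omega> \<in> space M. Q (path \<omega>)} =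
    (\<lambda>\<omega>. \<lambda>i\<in>{1..n}. \<zeta> i \<omega>) -` {w \<in> PiE {1..n} (\<lambda>_. UNIV). Q w} \<inter> space M"
proof -
  have "Q (path \<omega>) = Q (\<lambda>i\<in>{1..n}. \<zeta> i \<omega>)" for \<omega>
    by (rule determined_byD[OF assms]) auto
  then show ?thesis by auto
qed

lemma determined_by_sets:
  assumes "determined_by n Q"
  shows "{\<omega> \<in> space M. Q (path \<omega>)} \<in> events"
proof -
  have "(\<lambda>\<omega>. \<lambda>i\<in>{1..n}. \<zeta> i \<omega>) \<in> measurable M (PiM {1..n} (\<lambda>_. count_space UNIV))"
    by (intro measurable_restrict measurable_trial) auto
  then show ?thesis
    unfolding determined_by_vimage[OF assms] by (rule measurable_sets) (subst PiM_trials, auto)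
qed

text \<open>Vectors of trials over the disjoint index sets \<open>{1..n}\<close> and
  \<open>{Suc n}\<close> are independent.\<close>

lemma prob_next_trial:
  assumes Q: "determined_by n Q"
  shows "prob {\<omega> \<in> space M. Q (path \<omega>) \<and> \<zeta> (Suc n) \<omega> = b} =
    prob {\<omega> \<in> space M. Q (path \<omega>)} * prob {\<omega> \<in> space M. \<zeta> (Suc n) \<omega> = b}"
proof -
  let ?C = "\<lambda>_::nat. count_space UNIV :: nat measure"
  let ?A = "{w \<in> PiE {1..n} (\<lambda>_. UNIV). Q w}"
  let ?B = "{w \<in> PiE {Suc n} (\<lambda>_. UNIV). w (Suc n) = b}"
  have iv: "indep_var (PiM {1..n} ?C) (\<lambda>\<omega>. \<lambda>i\<in>{1..n}. \<zeta> i \<omega>)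
      (PiM {Suc n} ?C) (\<lambda>\<omega>. \<lambda>i\<in>{Suc n}. \<zeta> i \<omega>)"
    by (rule indep_var_restrict[OF indep]) auto
  have S: "PiM {Suc n} ?C = count_space (PiE {Suc n} (\<lambda>_. UNIV))"
    by (rule count_space_PiM_finite) auto
  have B: "{\<omega> \<in> space M. \<zeta> (Suc n) \<omega> = b} = (\<lambda>\<omega>. \<lambda>i\<in>{Suc n}. \<zeta> i \<omega>) -` ?B \<inter> space M"
    by auto
  have AB: "{\<omega> \<in> space M. Q (path \<omega>) \<and> \<zeta> (Suc n) \<omega> = b} =
     (\<lambda>\<omega>. ((\<lambda>i\<in>{1..n}. \<zeta> i \<omega>), (\<lambda>i\<in>{Suc n}. \<zeta> i \<omega>))) -` (?A \<times> ?B) \<inter> space M"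
    using determined_by_vimage[OF Q] B by auto
  have "?A \<in> sets (PiM {1..n} ?C)" "?B \<in> sets (PiM {Suc n} ?C)"
    unfolding PiM_trials S by auto
  from indep_varD[OF iv this] show ?thesis
    unfolding AB determined_by_vimage[OF Q] B by simp
qed

text \<open>Both facts are stated together so that runs can be chained: the first conjunct is the
  hypothesis for appending the next run.\<close>

lemma prob_trial_run:
  assumes Q: "determined_by n Q"
    and b: "\<And>i. 1 \<le> i \<Longrightarrow> prob {\<omega> \<in> space M. \<zeta> i \<omega> = b} = w"
  shows "determined_by (n + c) (\<lambda>x. Q x \<and> (\<forall>u\<in>{Suc n..n + c}. x u = b)) \<and>
    prob {\<omega> \<in> space M. Q (path \<omega>) \<and> (\<forall>u\<in>{Suc n..n + c}. \<zeta> u \<omega> = b)} =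
    prob {\<omega> \<in> space M. Q (path \<omega>)} * w ^ c"
proof (induction c)
  case 0
  then show ?case using Q by simp
next
  case (Suc c)
  let ?R = "\<lambda>x::nat\<Rightarrow>nat. Q x \<and> (\<forall>u\<in>{Suc n..n + c}. x u = b)"
  have R: "{Suc n..n + Suc c} = insert (Suc (n + c)) {Suc n..n + c}" by auto
  have D: "determined_by (n + c) ?R" using Suc by simp
  have "{\<omega> \<in> space M. Q (path \<omega>) \<and> (\<forall>u\<in>{Suc n..n + Suc c}. \<zeta> u \<omega> = b)} =
     {\<omega> \<in> space M. ?R (path \<omega>) \<and> \<zeta> (Suc (n + c)) \<omega> = b}" unfolding R by auto
  moreover have "determined_by (n + Suc c) (\<lambda>x. Q x \<and> (\<forall>u\<in>{Suc n..n + Suc c}. x u = b))"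
  proof (rule determined_by_conj)
    show "determined_by (n + Suc c) Q" by (rule determined_by_mono[OF Q]) simp
    show "determined_by (n + Suc c) (\<lambda>x. \<forall>u\<in>{Suc n..n + Suc c}. x u = b)"
      unfolding determined_by_def by auto
  qed
  ultimately show ?case
    using prob_next_trial[OF D, of b] Suc b[of "Suc (n + c)"] by (simp add: mult_ac)
qed

text \<open>The first zero of the block is part of \<open>Q\<close>. What remains is
  \<open>j - 1\<close> zeros, \<open>i\<close> ones and the terminal zero; the terminal zero
  supplies the missing factor \<open>q\<close>.\<close>

lemma prob_cycle:
  assumes Q: "determined_by s Q" and Q0: "\<And>x. Q x \<Longrightarrow> zero_block_starts s x"
    and ji: "1 \<le> j" "1 \<le> i"
  shows "prob {\<omega> \<in> space M. Q (path \<omega>) \<and> cycle_at s j i (path \<omega>)} =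
    prob {\<omega> \<in> space M. Q (path \<omega>)} * (q ^ j * p ^ i)"
proof -
  let ?R1 = "\<lambda>x::nat\<Rightarrow>nat. Q x \<and> (\<forall>u\<in>{Suc s..s + (j - 1)}. x u = 0)"
  let ?R2 = "\<lambda>x::nat\<Rightarrow>nat. ?R1 x \<and> (\<forall>u\<in>{Suc (s + (j - 1))..s + (j - 1) + i}. x u = 1)"
  let ?R3 = "\<lambda>x::nat\<Rightarrow>nat. ?R2 x \<and> (\<forall>u\<in>{Suc (s + (j - 1) + i)..s + (j - 1) + i + 1}. x u = 0)"
  \<comment> \<open>Three runs in a row: the rest of the zero block, the ones, the closing
    zero.\<close>
  note 1 = prob_trial_run[OF Q prob_zero, of "j - 1"]
  note 2 = prob_trial_run[OF conjunct1[OF 1] prob_one, of i]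
  note 3 = prob_trial_run[OF conjunct1[OF 2] prob_zero, of 1]
  have eq: "Q x \<and> cycle_at s j i x \<longleftrightarrow> ?R3 x" for x
  proof
    assume "Q x \<and> cycle_at s j i x"
    then show "?R3 x" using ji unfolding cycle_at_def by auto
  next
    assume R: "?R3 x"
    then have z: "zero_block_starts s x" using Q0 by blast
    have "\<forall>u\<in>{s..<s + j}. x u = 0"
    proof
      fix u assume "u \<in> {s..<s + j}"
      then have "u = s \<or> u \<in> {Suc s..s + (j - 1)}" using ji by auto
      then show "x u = 0" using R z by (auto simp: zero_block_starts_def)
    qed
    moreover have "\<forall>u\<in>{s + j..<s + j + i}. x u = 1"
    proof -
      have "{s + j..<s + j + i} = {Suc (s + (j - 1))..s + (j - 1) + i}" using ji by auto
      then show ?thesis using R by simp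
    qed
    moreover have "x (s + j + i) = 0"
    proof -
      have "s + j + i = Suc (s + (j - 1) + i)" using ji by simp
      then show ?thesis using R by simp
    qed
    ultimately show "Q x \<and> cycle_at s j i x"
      using R z ji by (simp add: cycle_at_def zero_block_starts_def)
  qed
  have "prob {\<omega> \<in> space M. Q (path \<omega>) \<and> cycle_at s j i (path \<omega>)} =
     prob {\<omega> \<in> space M. Q (path \<omega>)} * q ^ (j - 1) * p ^ i * q ^ 1"
    unfolding eq using 1 2 3 by simp
  also have "\<dots> = prob {\<omega> \<in> space M. Q (path \<omega>)} * (q ^ j * p ^ i)"
    using ji by (cases j) (auto simp: mult_ac)
  finally show ?thesis .
qed

text \<open>The trials are natural-valued; other values have probability zero because
  \<open>p + q = 1\<close>. The existence of a last cycle needs this.\<close>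

lemma AE_binary: "AE \<omega> in M. \<forall>u\<ge>1. \<zeta> u \<omega> = 0 \<or> \<zeta> u \<omega> = 1"
proof -
  have "AE \<omega> in M. \<zeta> u \<omega> = 0 \<or> \<zeta> u \<omega> = 1" if u: "1 \<le> u" for u
  proof -
    have ev: "{\<omega> \<in> space M. \<zeta> u \<omega> = b} \<in> events" for b
      using measurable_sets[OF measurable_trial[OF u], of "{b}"] by (simp add: vimage_def Int_def conj_commute)
    have "prob ({\<omega> \<in> space M. \<zeta> u \<omega> = 0} \<union> {\<omega> \<in> space M. \<zeta> u \<omega> = 1}) = 1"
      by (subst finite_measure_Union) (use ev prob_zero[OF u] prob_one[OF u] q_eq in auto)
    from AE_prob_1[OF this] show ?thesis by simp
  qed
  then have "AE \<omega> in M. \<forall>u. 1 \<le> u \<longrightarrow> \<zeta> u \<omega> = 0 \<or> \<zeta> u \<omega> = 1"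
    by (subst AE_all_countable) auto
  then show ?thesis by simp
qed

end

section \<open>Last-cycle decomposition\<close>

locale pattern_trials = bernoulli_trials +
  fixes l1 k1 l2 k2 :: nat
  assumes l1_pos: "1 \<le> l1" and l1_le: "l1 \<le> k1" and l2_pos: "1 \<le> l2" and l2_le: "l2 \<le> k2"
begin

abbreviation good :: "nat \<Rightarrow> nat \<Rightarrow> bool" where
  "good j i \<equiv> l1 \<le> j \<and> j \<le> k1 \<and> l2 \<le> i \<and> i \<le> k2"

abbreviation cnt :: "nat \<Rightarrow> (nat \<Rightarrow> nat) \<Rightarrow> nat" where
  "cnt \<equiv> pattern_count l1 k1 l2 k2"

text \<open>Plays the role of \<open>f\<close> in \<open>pattern_recursion\<close>, with
  \<open>wait_prob\<close> as \<open>g\<close>.\<close>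

definition start_prob :: "nat \<Rightarrow> nat \<Rightarrow> real" where
  "start_prob r n = prob {\<omega> \<in> space M. zero_block_starts n (path \<omega>) \<and> cnt n (path \<omega>) = r}"

definition wait_prob :: "nat \<Rightarrow> nat \<Rightarrow> real" where
  "wait_prob r m = prob {\<omega> \<in> space M. waiting_time l1 k1 l2 k2 r (path \<omega>) = enat m}"

text \<open>The predicate \<open>P\<close> is left open to cover a prescribed count as well as a
  count that the next cycle may increase.\<close>

lemma determined_by_start: "determined_by n (\<lambda>x. zero_block_starts n x \<and> P (cnt n x))"
  unfolding determined_by_def
proof (intro allI impI)
  fix x y :: "nat \<Rightarrow> nat"
  assume A: "\<forall>u\<in>{1..n}. x u = y u"
  then have "cnt n x = cnt n y" by (intro pattern_count_cong l1_pos l2_pos) auto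
  moreover have "zero_block_starts n x = zero_block_starts n y"
  proof (cases "1 < n")
    case True
    then have "n \<in> {1..n}" "n - 1 \<in> {1..n}" by auto
    then show ?thesis using A by (simp add: zero_block_starts_def)
  next
    case False
    then have "n = 0 \<or> n = 1" by auto
    then show ?thesis using A by (auto simp: zero_block_starts_def)
  qed
  ultimately show "(zero_block_starts n x \<and> P (cnt n x)) = (zero_block_starts n y \<and> P (cnt n y))"
    by simp
qed

lemma determined_by_cycle: "determined_by (s + j + i) (cycle_at s j i)"
proof -
  have imp: "cycle_at s j i y" if C: "cycle_at s j i x" and xy: "\<forall>u\<in>{1..s + j + i}. x u = y u" for x y
  proof -
    have s: "1 \<le> s" "1 \<le> j" "1 \<le> i" "s = 1 \<or> x (s - 1) = 1" "x (s + j + i) = 0"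
      using C by (simp_all add: cycle_at_def)
    have y: "y u = x u" if "1 \<le> u" "u \<le> s + j + i" for u using xy that by simp
    show ?thesis unfolding cycle_at_def
    proof (intro conjI ballI)
      show "s = 1 \<or> y (s - 1) = 1"
        using s y[of "s - 1"] by (cases "s = 1") simp_all
      show "y u = 0" if "u \<in> {s..<s + j}" for u
        using that s(1) y[of u] cycle_at_zero[OF C, of u] by simp
      show "y u = 1" if "u \<in> {s + j..<s + j + i}" for u
        using that s(1) y[of u] cycle_at_one[OF C, of u] by simp
      show "y (s + j + i) = 0" using s y[of "s + j + i"] by simp
    qed (use s in simp_all)
  qed
  have sym: "\<forall>u\<in>{1..s + j + i}. y u = x u" if "\<forall>u\<in>{1..s + j + i}. x u = y u" for x y :: "nat \<Rightarrow> nat"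
    using that by simp
  show ?thesis unfolding determined_by_def using imp sym by blast
qed

text \<open>The common source of both renewal equations: the event is partitioned by the lengths of
  the cycle ending at \<open>n\<close>. The condition \<open>Q\<close> on the state at its start may
  depend on these lengths, which decide whether the count grows. Summation from 0 with indicator
  weights prepares for Cauchy products.\<close>

lemma prob_ends_with_cycle:
  fixes n :: nat and Q :: "nat \<Rightarrow> nat \<Rightarrow> (nat \<Rightarrow> nat) \<Rightarrow> bool"
  defines "E \<equiv> \<lambda>x. \<exists>j i. 1 \<le> j \<and> 1 \<le> i \<and> j + i \<le> n \<and> Q j i x \<and> cycle_at (n - j - i) j i x"
  assumes Q: "\<And>j i. determined_by (n - j - i) (Q j i)"
    and Q0: "\<And>j i x. Q j i x \<Longrightarrow> zero_block_starts (n - j - i) x"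
  shows "prob {\<omega> \<in> space M. E (path \<omega>)} =
      (\<Sum>j=0..n. \<Sum>i=0..n - j. of_bool (1 \<le> j \<and> 1 \<le> i) * q ^ j * p ^ i *
         prob {\<omega> \<in> space M. Q j i (path \<omega>)})"
    and "{\<omega> \<in> space M. E (path \<omega>)} \<in> events"
proof -
  let ?T = "SIGMA j:{0..n}. {0..n - j}"
  define A where "A = (\<lambda>(j, i). {\<omega> \<in> space M. 1 \<le> j \<and> 1 \<le> i \<and> Q j i (path \<omega>) \<and>
     cycle_at (n - j - i) j i (path \<omega>)})"
  have un: "{\<omega> \<in> space M. E (path \<omega>)} = (\<Union>t\<in>?T. A t)"
    unfolding E_def A_def by force
  have disj: "disjoint_family_on A ?T"
    unfolding disjoint_family_on_def
  proof (intro ballI impI)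
    fix t t' assume t: "t \<in> ?T" "t' \<in> ?T" "t \<noteq> t'"
    obtain j i j' i' where e: "t = (j, i)" "t' = (j', i')" by fastforce
    \<comment> \<open>Both cycles end at \<open>n\<close>, since membership in \<open>?T\<close>
      makes the truncated differences exact.\<close>
    have "\<not> (cycle_at (n - j - i) j i x \<and> cycle_at (n - j' - i') j' i' x)" for x
      using cycle_at_unique[of "n - j - i" j i x "n - j' - i'" j' i'] t e by auto
    then show "A t \<inter> A t' = {}" unfolding A_def e by auto
  qed
  have A: "A (j, i) \<in> events \<and> prob (A (j, i)) = of_bool (1 \<le> j \<and> 1 \<le> i) * q ^ j * p ^ i *
         prob {\<omega> \<in> space M. Q j i (path \<omega>)}" if "(j, i) \<in> ?T" for j i
  proof (cases "1 \<le> j \<and> 1 \<le> i")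
    case True
    have "j + i \<le> n" using that by auto
    then have s: "n - j - i + j + i = n" by simp
    have "determined_by n (\<lambda>x. cycle_at (n - j - i) j i x \<and> Q j i x)"
    proof (rule determined_by_conj)
      show "determined_by n (Q j i)" by (rule determined_by_mono[OF Q]) simp
      show "determined_by n (cycle_at (n - j - i) j i)"
        using determined_by_cycle[of "n - j - i" j i] unfolding s .
    qed
    from determined_by_sets[OF this] have "A (j, i) \<in> events"
      using True by (simp add: A_def conj_commute)
    moreover have "prob (A (j, i)) = prob {\<omega> \<in> space M. Q j i (path \<omega>)} * (q ^ j * p ^ i)"
      using prob_cycle[OF Q[of j i], of j i] Q0 True by (simp add: A_def)
    ultimately show ?thesis using True by simp
  next
    case False
    then have "A (j, i) = {}" by (auto simp: A_def)
    then show ?thesis using False by auto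
  qed
  show "{\<omega> \<in> space M. E (path \<omega>)} \<in> events"
    unfolding un using A by (intro sets.finite_UN) auto
  have "prob (\<Union>t\<in>?T. A t) = (\<Sum>t\<in>?T. prob (A t))"
    by (rule finite_measure_finite_Union) (use A disj in auto)
  also have "\<dots> = (\<Sum>(j, i)\<in>?T. of_bool (1 \<le> j \<and> 1 \<le> i) * q ^ j * p ^ i *
         prob {\<omega> \<in> space M. Q j i (path \<omega>)})"
    by (rule sum.cong) (use A in auto)
  finally show "prob {\<omega> \<in> space M. E (path \<omega>)} =
      (\<Sum>j=0..n. \<Sum>i=0..n - j. of_bool (1 \<le> j \<and> 1 \<le> i) * q ^ j * p ^ i *
         prob {\<omega> \<in> space M. Q j i (path \<omega>)})"
    unfolding un by (simp add: sum.Sigma)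
qed

text \<open>The cycle that completes occurrence \<open>Suc r\<close> is good, so only the good
  lengths contribute.\<close>

lemma wait_prob_Suc:
  "wait_prob (Suc r) n = (\<Sum>j=0..n. \<Sum>i=0..n - j.
     of_bool (good j i) * q ^ j * p ^ i * start_prob r (n - j - i))"
proof -
  let ?Q = "\<lambda>j i x. zero_block_starts (n - j - i) x \<and> (good j i \<and> cnt (n - j - i) x = r)"
  have eq: "waiting_time l1 k1 l2 k2 (Suc r) x = enat n \<longleftrightarrow>
      (\<exists>j i. 1 \<le> j \<and> 1 \<le> i \<and> j + i \<le> n \<and> ?Q j i x \<and> cycle_at (n - j - i) j i x)" for x
    unfolding waiting_time_Suc_iff[OF l1_pos l2_pos]
  proof
    assume "\<exists>s j i. s + j + i = n \<and> good j i \<and> cycle_at s j i x \<and> cnt s x = r"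
    then obtain s j i where A: "s + j + i = n" "good j i" "cycle_at s j i x" "cnt s x = r" by blast
    then have "n - j - i = s" by simp
    moreover have "1 \<le> j" "1 \<le> i" using A(3) by (simp_all add: cycle_at_def)
    ultimately show "\<exists>j i. 1 \<le> j \<and> 1 \<le> i \<and> j + i \<le> n \<and> ?Q j i x \<and> cycle_at (n - j - i) j i x"
      using A zero_block_starts_of_cycle[OF A(3)] by (intro exI[of _ j] exI[of _ i]) simp
  next
    assume "\<exists>j i. 1 \<le> j \<and> 1 \<le> i \<and> j + i \<le> n \<and> ?Q j i x \<and> cycle_at (n - j - i) j i x"
    then obtain j i where "j + i \<le> n" "?Q j i x" "cycle_at (n - j - i) j i x" by blast
    then show "\<exists>s j i. s + j + i = n \<and> good j i \<and> cycle_at s j i x \<and> cnt s x = r"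
      by (intro exI[of _ "n - j - i"] exI[of _ j] exI[of _ i]) simp
  qed
  have "wait_prob (Suc r) n = (\<Sum>j=0..n. \<Sum>i=0..n - j. of_bool (1 \<le> j \<and> 1 \<le> i) * q ^ j * p ^ i *
         prob {\<omega> \<in> space M. ?Q j i (path \<omega>)})"
    unfolding wait_prob_def eq
    by (rule prob_ends_with_cycle(1)) (use determined_by_start in auto)
  also have "\<dots> = (\<Sum>j=0..n. \<Sum>i=0..n - j.
     of_bool (good j i) * q ^ j * p ^ i * start_prob r (n - j - i))"
    using l1_pos l2_pos by (intro sum.cong refl) (auto simp: start_prob_def of_bool_def)
  finally show ?thesis .
qed

lemma prob_all_ones_then_zero:
  assumes "1 \<le> n"
  shows "prob {\<omega> \<in> space M. (\<forall>u\<in>{1..<n}. \<zeta> u \<omega> = 1) \<and> \<zeta> n \<omega> = 0} = p ^ (n - 1) * q"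
    and "{\<omega> \<in> space M. (\<forall>u\<in>{1..<n}. \<zeta> u \<omega> = 1) \<and> \<zeta> n \<omega> = 0} \<in> events"
proof -
  have Q: "determined_by 0 (\<lambda>_. True)" by (simp add: determined_by_def)
  note 1 = prob_trial_run[OF Q prob_one, of "n - 1"]
  note 2 = prob_trial_run[OF conjunct1[OF 1] prob_zero, of 1]
  have e: "{1..<n} = {Suc 0..0 + (n - 1)}" "{Suc (0 + (n - 1))..0 + (n - 1) + 1} = {n}"
    using assms by auto
  show "prob {\<omega> \<in> space M. (\<forall>u\<in>{1..<n}. \<zeta> u \<omega> = 1) \<and> \<zeta> n \<omega> = 0} = p ^ (n - 1) * q"
    using 1 2 unfolding e by (simp add: prob_space)
  show "{\<omega> \<in> space M. (\<forall>u\<in>{1..<n}. \<zeta> u \<omega> = 1) \<and> \<zeta> n \<omega> = 0} \<in> events"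
    using determined_by_sets[OF conjunct1[OF 2]] unfolding e by simp
qed

text \<open>Either \<open>n\<close> carries the first zero of the path, and then the count is 0, or
  a last cycle ends at \<open>n\<close>. A good last cycle raises the count, so it started with
  count \<open>r - 1\<close>; this is impossible for \<open>r = 0\<close>.\<close>

lemma start_prob_rec:
  "start_prob r n = of_bool (r = 0 \<and> 1 \<le> n) * (p ^ (n - 1) * q) +
    (\<Sum>j=0..n. \<Sum>i=0..n - j. of_bool (1 \<le> j \<and> 1 \<le> i) * q ^ j * p ^ i *
       (if good j i then if r = 0 then 0 else start_prob (r - 1) (n - j - i)
        else start_prob r (n - j - i)))"
proof -
  let ?Q = "\<lambda>j i x. zero_block_starts (n - j - i) x \<and> cnt (n - j - i) x + of_bool (good j i) = r"
  let ?E = "\<lambda>x. \<exists>j i. 1 \<le> j \<and> 1 \<le> i \<and> j + i \<le> n \<and> ?Q j i x \<and> cycle_at (n - j - i) j i x"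
  let ?F = "\<lambda>x::nat\<Rightarrow>nat. r = 0 \<and> 1 \<le> n \<and> (\<forall>u\<in>{1..<n}. x u = 1) \<and> x n = 0"
  have det: "determined_by (n - j - i) (?Q j i)" for j i by (rule determined_by_start)
  note E = prob_ends_with_cycle[where Q = ?Q, OF det conjunct1]
  have F: "prob {\<omega> \<in> space M. ?F (path \<omega>)} = of_bool (r = 0 \<and> 1 \<le> n) * (p ^ (n - 1) * q)"
    "{\<omega> \<in> space M. ?F (path \<omega>)} \<in> events"
    using prob_all_ones_then_zero[of n] by (cases "r = 0 \<and> 1 \<le> n"; auto)+
  have decomp_sound: "zero_block_starts n x \<and> cnt n x = r" if "?F x \<or> ?E x" for x
    using that
  proof
    assume A: "?F x"
    then have "cnt n x = 0" by (intro pattern_count_all_ones l1_pos l2_pos) simp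
    moreover have "zero_block_starts n x"
    proof (cases "n = 1")
      case True
      then show ?thesis using A by (simp add: zero_block_starts_def)
    next
      case False
      then have "n - 1 \<in> {1..<n}" using A by auto
      then show ?thesis using A by (simp add: zero_block_starts_def)
    qed
    ultimately show ?thesis using A by simp
  next
    assume "?E x"
    then obtain j i where ji: "j + i \<le> n" and Q: "?Q j i x" and C: "cycle_at (n - j - i) j i x"
      by blast
    have s: "n - j - i + j + i = n" using ji by simp
    show ?thesis
      using zero_block_starts_after_cycle[OF C] pattern_count_after_cycle[OF l1_pos l2_pos C] Q
      unfolding s by simp
  qed
  have decomp_complete: "?F x \<or> ?E x" if bin: "\<forall>u\<ge>1. x u = 0 \<or> x u = 1" and st: "zero_block_starts n x \<and> cnt n x = r" for x
  proof (cases "\<forall>u\<in>{1..<n}. x u = 1")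
    case True
    then show ?thesis using st pattern_count_all_ones[OF l1_pos l2_pos True]
      by (auto simp: zero_block_starts_def)
  next
    case False
    then obtain s j i where C: "cycle_at s j i x" and n: "s + j + i = n"
      using last_cycle_exists[of x n] bin st by blast
    have ji: "1 \<le> j" "1 \<le> i" and s: "n - j - i = s" using C n by (auto simp: cycle_at_def)
    have "?Q j i x"
      using zero_block_starts_of_cycle[OF C] pattern_count_after_cycle[OF l1_pos l2_pos C] st
      unfolding s n by simp
    then have "?E x" using ji C n s by (intro exI[of _ j] exI[of _ i]) simp
    then show ?thesis ..
  qed
  \<comment> \<open>A last cycle puts a zero before \<open>n\<close>, whereas \<open>?F\<close> has
    only ones there.\<close>
  have disj: "{\<omega> \<in> space M. ?F (path \<omega>)} \<inter> {\<omega> \<in> space M. ?E (path \<omega>)} = {}"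
  proof -
    have exclusive: False if "?F x" "?E x" for x
    proof -
      from that(2) obtain j i where ji: "1 \<le> i" "j + i \<le> n" "cycle_at (n - j - i) j i x" by blast
      then have "1 \<le> n - j - i" "x (n - j - i) = 0" "n - j - i < n"
        by (auto simp: cycle_at_def)
      then show False using that(1) by force
    qed
    have "{\<omega> \<in> S. P \<omega>} \<inter> {\<omega> \<in> S. Q \<omega>} = {}" if "\<And>\<omega>. P \<omega> \<Longrightarrow> Q \<omega> \<Longrightarrow> False" for S P Q
      using that by auto
    from this[of "\<lambda>\<omega>. ?F (path \<omega>)" "\<lambda>\<omega>. ?E (path \<omega>)", OF exclusive] show ?thesis .
  qed
  have Qprob: "prob {\<omega> \<in> space M. ?Q j i (path \<omega>)} =
      (if good j i then if r = 0 then 0 else start_prob (r - 1) (n - j - i)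
        else start_prob r (n - j - i))" for j i
  proof (cases "good j i")
    case True
    then have "{\<omega> \<in> space M. ?Q j i (path \<omega>)} = (if r = 0 then {} else
       {\<omega> \<in> space M. zero_block_starts (n - j - i) (path \<omega>) \<and> cnt (n - j - i) (path \<omega>) = r - 1})"
      by auto
    then show ?thesis using True by (simp add: start_prob_def)
  next
    case False
    then show ?thesis by (auto simp: start_prob_def)
  qed
  have "start_prob r n = prob ({\<omega> \<in> space M. ?F (path \<omega>)} \<union> {\<omega> \<in> space M. ?E (path \<omega>)})"
    unfolding start_prob_def
  proof (rule finite_measure_eq_AE)
    \<comment> \<open>The decomposition is exact only on paths with values 0 and 1, hence almost
      everywhere.\<close>
    show "AE \<omega> in M. \<omega> \<in> {\<omega> \<in> space M. zero_block_starts n (path \<omega>) \<and> cnt n (path \<omega>) = r} \<longleftrightarrow>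
       \<omega> \<in> {\<omega> \<in> space M. ?F (path \<omega>)} \<union> {\<omega> \<in> space M. ?E (path \<omega>)}"
      using AE_binary AE_space
    proof eventually_elim
      case (elim \<omega>)
      have mem: "\<omega> \<in> {\<omega> \<in> S. Z \<omega>} \<longleftrightarrow> \<omega> \<in> {\<omega> \<in> S. P \<omega>} \<union> {\<omega> \<in> S. Q \<omega>}"
        if "Z \<omega> \<longleftrightarrow> P \<omega> \<or> Q \<omega>" for S Z P Q using that by auto
      show ?case
        by (rule mem, rule iffI, erule decomp_complete[OF elim(1)], erule decomp_sound)
    qed
    show "{\<omega> \<in> space M. zero_block_starts n (path \<omega>) \<and> cnt n (path \<omega>) = r} \<in> events"
      by (rule determined_by_sets[OF determined_by_start])
    show "{\<omega> \<in> space M. ?F (path \<omega>)} \<union> {\<omega> \<in> space M. ?E (path \<omega>)} \<in> events"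
      by (rule sets.Un[OF F(2) E(2)])
  qed
  also have "\<dots> = of_bool (r = 0 \<and> 1 \<le> n) * (p ^ (n - 1) * q) +
     (\<Sum>j=0..n. \<Sum>i=0..n - j. of_bool (1 \<le> j \<and> 1 \<le> i) * q ^ j * p ^ i *
         prob {\<omega> \<in> space M. ?Q j i (path \<omega>)})"
  proof -
    have "prob {\<omega> \<in> space M. ?E (path \<omega>)} = (\<Sum>j=0..n. \<Sum>i=0..n - j.
       of_bool (1 \<le> j \<and> 1 \<le> i) * q ^ j * p ^ i * prob {\<omega> \<in> space M. ?Q j i (path \<omega>)})"
      by (rule E(1))
    with F(1) show ?thesis
      by (intro trans[OF finite_measure_Union[OF F(2) E(2) disj]] arg_cong2[where f = "(+)"])
  qed
  finally show ?thesis unfolding Qprob .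
qed

end

section \<open>Power series\<close>

text \<open>A shift with zeros filled in, matching a function on the integers that vanishes at
  negative arguments.\<close>

definition delay :: "nat \<Rightarrow> (nat \<Rightarrow> 'a::zero) \<Rightarrow> nat \<Rightarrow> 'a" where
  "delay c f n = (if n < c then 0 else f (n - c))"

lemma fps_X_power_mult_Abs_fps: "fps_X ^ c * Abs_fps f = Abs_fps (delay c f)"
  by (rule fps_ext) (simp add: fps_X_power_mult_nth delay_def)

text \<open>The weight \<open>\<phi>\<close> is general because it is used with powers of
  \<open>t\<close> for generating functions and with powers of \<open>n\<close> for moments.\<close>

lemma sums_delay:
  fixes f :: "nat \<Rightarrow> real" and \<phi> :: "nat \<Rightarrow> 'b::{real_normed_field}"
  assumes "(\<lambda>n. of_real (f n) * \<phi> (n + c)) sums s"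
  shows "(\<lambda>n. of_real (delay c f n) * \<phi> n) sums s"
proof -
  have "(\<lambda>n. of_real (delay c f (n + c)) * \<phi> (n + c)) sums s"
    using assms by (simp add: delay_def)
  moreover have "(\<Sum>n<c. of_real (delay c f n) * \<phi> n) = 0"
    by (rule sum.neutral) (simp add: delay_def)
  ultimately show ?thesis
    using sums_iff_shift[of "\<lambda>n. of_real (delay c f n) * \<phi> n" c s] by simp
qed

lemma fps_geometric_segment:
  fixes c :: "'a::field"
  assumes "a \<le> b"
  shows "(1 - fps_const c * fps_X) * Abs_fps (\<lambda>j. of_bool (a \<le> j \<and> j \<le> b) * c ^ j) =
    (fps_const c * fps_X) ^ a * (1 - (fps_const c * fps_X) ^ (b - a + 1))"
proof -
  let ?x = "fps_const c * fps_X :: 'a fps"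
  have "Abs_fps (\<lambda>j. of_bool (a \<le> j \<and> j \<le> b) * c ^ j) = (\<Sum>j=a..b. ?x ^ j)"
    by (rule fps_ext) (auto simp: fps_sum_nth power_mult_distrib if_distrib fps_const_power cong: if_cong)
  moreover have "a + (b - a + 1) = Suc b" using assms by simp
  ultimately show ?thesis
    using sum_gp_multiplied[OF assms, of ?x] by (simp add: right_diff_distrib flip: power_add)
qed

lemma fps_geometric_tail:
  fixes c :: "'a::field"
  shows "(1 - fps_const c * fps_X) * Abs_fps (\<lambda>j. of_bool (1 \<le> j) * c ^ j) = fps_const c * fps_X"
proof (rule fps_ext)
  fix n
  show "fps_nth ((1 - fps_const c * fps_X) * Abs_fps (\<lambda>j. of_bool (1 \<le> j) * c ^ j)) n =
      fps_nth (fps_const c * fps_X) n"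
    by (cases n; cases "n - 1") (auto simp: left_diff_distrib mult.assoc)
qed

text \<open>Separates the number of zeros, the number of ones and the state before the cycle into
  three factors.\<close>

lemma Abs_fps_double_convolution:
  fixes f :: "nat \<Rightarrow> 'a::comm_ring_1"
  shows "Abs_fps (\<lambda>n. \<Sum>j=0..n. \<Sum>i=0..n - j. u j * v i * f (n - j - i)) =
    Abs_fps u * (Abs_fps v * Abs_fps f)"
  by (rule fps_ext) (simp add: fps_mult_nth sum_distrib_left mult.assoc)

section \<open>The numerator and its action on sequences\<close>

locale pattern_series =
  fixes p q a :: real and l1 k1 l2 k2 l m1 m2 :: nat
  assumes p_pos: "0 < p" and p_less_1: "p < 1" and q_eq: "q = 1 - p"
    and l1_pos: "1 \<le> l1" and l1_le: "l1 \<le> k1" and l2_pos: "1 \<le> l2" and l2_le: "l2 \<le> k2"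
    and a_eq: "a = q ^ l1 * p ^ l2" and l_eq: "l = l1 + l2"
    and m1_eq: "m1 = k1 - l1 + 1" and m2_eq: "m2 = k2 - l2 + 1"
begin

text \<open>This is \<open>(1 - q X) (1 - p X)\<close> times the generating polynomial of the good
  cycles, as shown in \<open>good_cycles\<close>.\<close>

definition numer :: "real fps" where
  "numer = fps_const a * fps_X ^ l *
     (1 - (fps_const q * fps_X) ^ m1) * (1 - (fps_const p * fps_X) ^ m2)"

text \<open>Coefficients of the polynomial \<open>(1 - (p X) ^ m2) / (1 - p X)\<close>, which enters
  the equation for \<open>G 1\<close>.\<close>

definition trunc_geom :: "nat \<Rightarrow> real" where
  "trunc_geom i = of_bool (i < m2) * p ^ i"

abbreviation numer_delay :: "(nat \<Rightarrow> real) \<Rightarrow> nat \<Rightarrow> real" where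
  "numer_delay f n \<equiv> a * (delay l f n - q ^ m1 * delay (l + m1) f n
     - p ^ m2 * delay (l + m2) f n + q ^ m1 * p ^ m2 * delay (l + m1 + m2) f n)"

lemma fps_const_X_power: "(fps_const c * fps_X) ^ n = fps_const (c ^ n :: real) * fps_X ^ n"
  by (simp add: power_mult_distrib fps_const_power)

lemma numer_mult: "numer * Abs_fps f = Abs_fps (numer_delay f)"
proof -
  have "numer * Abs_fps f = fps_const a * (fps_X ^ l * Abs_fps f
     - fps_const (q ^ m1) * (fps_X ^ (l + m1) * Abs_fps f)
     - fps_const (p ^ m2) * (fps_X ^ (l + m2) * Abs_fps f)
     + fps_const (q ^ m1 * p ^ m2) * (fps_X ^ (l + m1 + m2) * Abs_fps f))"
    unfolding numer_def fps_const_X_power power_add fps_const_mult[symmetric]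
    by (simp add: algebra_simps del: fps_const_mult)
  then show ?thesis
    unfolding fps_X_power_mult_Abs_fps by (intro fps_ext) simp
qed

lemma numer_eq: "numer = ((fps_const q * fps_X) ^ l1 * (1 - (fps_const q * fps_X) ^ m1)) *
    ((fps_const p * fps_X) ^ l2 * (1 - (fps_const p * fps_X) ^ m2))"
proof -
  have "fps_const a * fps_X ^ l = (fps_const q * fps_X) ^ l1 * (fps_const p * fps_X) ^ l2"
    unfolding fps_const_X_power l_eq power_add arg_cong[OF a_eq, of fps_const] fps_const_mult[symmetric]
    by (simp only: mult_ac)
  then show ?thesis unfolding numer_def by (simp only: mult_ac)
qed

text \<open>Real power series form an integral domain, so the geometric denominators can be
  cancelled.\<close>

lemma one_minus_nonzero: "1 - fps_const c * fps_X \<noteq> (0 :: real fps)"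
proof
  assume "1 - fps_const c * fps_X = (0 :: real fps)"
  then have "fps_nth (1 - fps_const c * fps_X :: real fps) 0 = 0" by simp
  then show False by simp
qed

end

text \<open>
  Multiplying the renewal equations for the starts of zero blocks by the geometric denominators
  leaves \<open>1 - X + numer\<close>, because \<open>(1 - q X) (1 - p X) - p q X\<^sup>2 = 1 - X\<close> when \<open>p + q = 1\<close>.
\<close>

locale pattern_recursion = pattern_series +
  fixes f g :: "nat \<Rightarrow> nat \<Rightarrow> real"
  assumes f_rec: "\<And>r n. f r n = of_bool (r = 0 \<and> 1 \<le> n) * (p ^ (n - 1) * q) +
    (\<Sum>j=0..n. \<Sum>i=0..n - j. of_bool (1 \<le> j \<and> 1 \<le> i) * q ^ j * p ^ i *
       (if l1 \<le> j \<and> j \<le> k1 \<and> l2 \<le> i \<and> i \<le> k2 then if r = 0 then 0 else f (r - 1) (n - j - i)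
        else f r (n - j - i)))"
    and g_rec: "\<And>r n. g (Suc r) n = (\<Sum>j=0..n. \<Sum>i=0..n - j.
       of_bool (l1 \<le> j \<and> j \<le> k1 \<and> l2 \<le> i \<and> i \<le> k2) * q ^ j * p ^ i * f r (n - j - i))"
begin

abbreviation "qX \<equiv> fps_const q * fps_X"
abbreviation "pX \<equiv> fps_const p * fps_X"
abbreviation "Zs \<equiv> Abs_fps (\<lambda>j. of_bool (1 \<le> j) * q ^ j)"
abbreviation "Os \<equiv> Abs_fps (\<lambda>i. of_bool (1 \<le> i) * p ^ i)"
abbreviation "Zg \<equiv> Abs_fps (\<lambda>j. of_bool (l1 \<le> j \<and> j \<le> k1) * q ^ j)"
abbreviation "Og \<equiv> Abs_fps (\<lambda>i. of_bool (l2 \<le> i \<and> i \<le> k2) * p ^ i)"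
abbreviation "F r \<equiv> Abs_fps (f r)"
abbreviation "G r \<equiv> Abs_fps (g r)"

lemma good_cycles: "(1 - qX) * Zg * ((1 - pX) * Og) = numer"
  unfolding fps_geometric_segment[OF l1_le] fps_geometric_segment[OF l2_le]
  unfolding m1_eq[symmetric] m2_eq[symmetric] numer_eq ..

text \<open>The case distinction in \<open>f_rec\<close> is not a product of a weight in
  \<open>j\<close> and a weight in \<open>i\<close>. It becomes a combination of products: all
  cycles at level \<open>r\<close>, minus the good ones at level \<open>r\<close>, plus the good
  ones at level \<open>r - 1\<close>.\<close>

lemma F_eq: "F r = of_bool (r = 0) * Abs_fps (\<lambda>n. of_bool (1 \<le> n) * (p ^ (n - 1) * q)) +
    Zs * (Os * F r) - Zg * (Og * F r) + Zg * (Og * Abs_fps (\<lambda>n. if r = 0 then 0 else f (r - 1) n))"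
proof -
  let ?c = "\<lambda>j i n. of_bool (1 \<le> j) * q ^ j * (of_bool (1 \<le> i) * p ^ i) * f r (n - j - i)"
  let ?d = "\<lambda>j i n. of_bool (l1 \<le> j \<and> j \<le> k1) * q ^ j * (of_bool (l2 \<le> i \<and> i \<le> k2) * p ^ i) * f r (n - j - i)"
  let ?e = "\<lambda>j i n. of_bool (l1 \<le> j \<and> j \<le> k1) * q ^ j * (of_bool (l2 \<le> i \<and> i \<le> k2) * p ^ i) *
     (if r = 0 then 0 else f (r - 1) (n - j - i))"
  have "of_bool (1 \<le> j \<and> 1 \<le> i) * q ^ j * p ^ i *
       (if l1 \<le> j \<and> j \<le> k1 \<and> l2 \<le> i \<and> i \<le> k2 then if r = 0 then 0 else f (r - 1) (n - j - i)
        else f r (n - j - i)) = ?c j i n - ?d j i n + ?e j i n" for j i n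
    using l1_pos l2_pos by auto
  then have f: "f r n = of_bool (r = 0) * (of_bool (1 \<le> n) * (p ^ (n - 1) * q)) +
     (\<Sum>j=0..n. \<Sum>i=0..n - j. ?c j i n) - (\<Sum>j=0..n. \<Sum>i=0..n - j. ?d j i n)
     + (\<Sum>j=0..n. \<Sum>i=0..n - j. ?e j i n)" for n
    unfolding f_rec[of r n] by (simp add: sum.distrib sum_subtractf)
  have "F r = Abs_fps (\<lambda>n. of_bool (r = 0) * (of_bool (1 \<le> n) * (p ^ (n - 1) * q)) +
     (\<Sum>j=0..n. \<Sum>i=0..n - j. ?c j i n) - (\<Sum>j=0..n. \<Sum>i=0..n - j. ?d j i n)
     + (\<Sum>j=0..n. \<Sum>i=0..n - j. ?e j i n))" by (intro arg_cong[where f = Abs_fps] ext f)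
  also have "\<dots> = of_bool (r = 0) * Abs_fps (\<lambda>n. of_bool (1 \<le> n) * (p ^ (n - 1) * q)) +
    Zs * (Os * F r) - Zg * (Og * F r) + Zg * (Og * Abs_fps (\<lambda>n. if r = 0 then 0 else f (r - 1) n))"
    unfolding Abs_fps_double_convolution[symmetric] by (intro fps_ext) auto
  finally show ?thesis .
qed

lemma F_numer: "(1 - fps_X + numer) * F r = of_bool (r = 0) * (qX * (1 - qX)) +
    numer * Abs_fps (\<lambda>n. if r = 0 then 0 else f (r - 1) n)"
proof -
  let ?B = "Abs_fps (\<lambda>n. of_bool (1 \<le> n) * (p ^ (n - 1) * q))"
  let ?P = "Abs_fps (\<lambda>n. if r = 0 then 0 else f (r - 1) n)"
  have B: "(1 - pX) * ?B = qX"
  proof (rule fps_ext)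
    fix n
    show "fps_nth ((1 - pX) * ?B) n = fps_nth qX n"
      by (cases n; cases "n - 1") (auto simp: left_diff_distrib mult.assoc)
  qed
  have sum_X: "qX + pX = fps_X"
    using q_eq by (intro fps_ext) (auto simp: fps_X_def)
  \<comment> \<open>Here \<open>u\<close> and \<open>v\<close> stand for the two geometric
    denominators; the factors are regrouped so that each meets the series that it clears.\<close>
  have ring: "u * v * x = d * (u * (v * b)) + (u * z) * (v * w) * x - (u * z') * (v * w') * x + (u * z') * (v * w') * y"
    if "x = d * b + z * (w * x) - z' * (w' * x) + z' * (w' * y)" for u v x d b z w z' w' y :: "real fps"
    using arg_cong[OF that, of "\<lambda>t. u * v * t"] by (simp add: algebra_simps)
  have "(1 - qX) * (1 - pX) * F r = of_bool (r = 0) * ((1 - qX) * ((1 - pX) * ?B)) +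
     ((1 - qX) * Zs) * ((1 - pX) * Os) * F r - ((1 - qX) * Zg * ((1 - pX) * Og)) * F r +
     ((1 - qX) * Zg * ((1 - pX) * Og)) * ?P"
    by (rule ring[OF F_eq])
  also have "\<dots> = of_bool (r = 0) * ((1 - qX) * qX) + qX * pX * F r - numer * F r + numer * ?P"
    unfolding B good_cycles fps_geometric_tail ..
  finally have "((1 - qX) * (1 - pX) - qX * pX + numer) * F r =
     of_bool (r = 0) * (qX * (1 - qX)) + numer * ?P"
    by (simp add: algebra_simps)
  moreover have "(1 - qX) * (1 - pX) - qX * pX = 1 - fps_X"
  proof -
    have "(1 - u) * (1 - v) - u * v = 1 - (u + v)" for u v :: "real fps" by (simp add: algebra_simps)
    from this[of qX pX] show ?thesis unfolding sum_X .
  qed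
  ultimately show ?thesis by simp
qed

lemma G_numer: "(1 - qX) * (1 - pX) * G (Suc r) = numer * F r"
proof -
  have "G (Suc r) = Zg * (Og * F r)"
    unfolding Abs_fps_double_convolution[symmetric]
    by (intro fps_ext) (auto simp: g_rec of_bool_def intro!: sum.cong)
  then show ?thesis unfolding good_cycles[symmetric] by (simp add: algebra_simps)
qed

text \<open>Combining \<open>G_numer\<close> with the equation for \<open>F 0\<close> leaves
  \<open>q X\<close> times \<open>numer\<close> after cancelling \<open>1 - q X\<close>. The factor
  \<open>1 - p X\<close> divides \<open>numer\<close>, so the right-hand side is again a
  polynomial.\<close>

lemma G_1: "(1 - fps_X + numer) * G 1 =
    fps_const (q * a) * (fps_X ^ (l + 1) * (1 - qX ^ m1)) * Abs_fps trunc_geom"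
proof -
  have "(1 - qX) * ((1 - pX) * ((1 - fps_X + numer) * G 1)) =
      (1 - fps_X + numer) * ((1 - qX) * (1 - pX) * G (Suc 0))" by (simp only: mult_ac One_nat_def)
  also have "\<dots> = numer * ((1 - fps_X + numer) * F 0)" unfolding G_numer by (simp only: mult_ac)
  also have "\<dots> = (1 - qX) * (qX * numer)"
    unfolding F_numer[of 0] by (simp add: mult_ac flip: fps_zero_def)
  finally have 1: "(1 - pX) * ((1 - fps_X + numer) * G 1) = qX * numer"
    using one_minus_nonzero[of q] by simp
  have "0 < m2" by (simp add: m2_eq)
  then have "j < m2 \<longleftrightarrow> 0 \<le> j \<and> j \<le> m2 - 1" for j by auto
  then have "Abs_fps trunc_geom = Abs_fps (\<lambda>j. of_bool (0 \<le> j \<and> j \<le> m2 - 1) * p ^ j)"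
    unfolding trunc_geom_def by simp
  then have 2: "1 - pX ^ m2 = (1 - pX) * Abs_fps trunc_geom"
    using fps_geometric_segment[of 0 "m2 - 1" p] \<open>0 < m2\<close> by simp
  have "(1 - pX) * ((1 - fps_X + numer) * G 1) =
      (1 - pX) * (fps_const (q * a) * (fps_X ^ (l + 1) * (1 - qX ^ m1)) * Abs_fps trunc_geom)"
    unfolding 1 unfolding numer_def 2 fps_const_mult[symmetric] power_add power_one_right
    by (simp only: mult_ac)
  then show ?thesis using one_minus_nonzero[of p] by simp
qed

text \<open>\<open>G_numer\<close> is used at two consecutive levels to eliminate \<open>F\<close>.
  Both levels must be at least 1, as \<open>G 0\<close> is not governed by
  \<open>G_numer\<close>.\<close>

lemma G_Suc:
  assumes "1 \<le> r"
  shows "(1 - fps_X + numer) * G (Suc r) = numer * G r"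
proof -
  obtain s where r: "r = Suc s" using assms by (cases r) auto
  have "(1 - qX) * (1 - pX) * ((1 - fps_X + numer) * G (Suc r)) =
     (1 - fps_X + numer) * ((1 - qX) * (1 - pX) * G (Suc r))" by (simp only: mult_ac)
  also have "\<dots> = numer * ((1 - fps_X + numer) * F r)" unfolding G_numer by (simp only: mult_ac)
  also have "(1 - fps_X + numer) * F r = numer * F s" using F_numer[of r] r by simp
  also have "numer * F s = (1 - qX) * (1 - pX) * G r" unfolding r G_numer ..
  also have "numer * ((1 - qX) * (1 - pX) * G r) = (1 - qX) * (1 - pX) * (numer * G r)"
    by (simp only: mult_ac)
  finally show ?thesis using one_minus_nonzero[of q] one_minus_nonzero[of p] by simp
qed

lemma g_1_rec: "g 1 n = delay 1 (g 1) n - numer_delay (g 1) n +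
    q * a * (delay (l + 1) trunc_geom n - q ^ m1 * delay (l + 1 + m1) trunc_geom n)"
proof -
  have "G 1 - fps_X ^ 1 * G 1 + numer * G 1 = fps_const (q * a) * (fps_X ^ (l + 1) * Abs_fps trunc_geom
     - fps_const (q ^ m1) * (fps_X ^ (l + 1 + m1) * Abs_fps trunc_geom))"
    using G_1 unfolding fps_const_X_power power_add by (simp add: algebra_simps)
  then have "fps_nth (G 1 - Abs_fps (delay 1 (g 1)) + Abs_fps (numer_delay (g 1))) n =
     fps_nth (fps_const (q * a) * (Abs_fps (delay (l + 1) trunc_geom)
       - fps_const (q ^ m1) * Abs_fps (delay (l + 1 + m1) trunc_geom))) n"
    unfolding fps_X_power_mult_Abs_fps numer_mult by simp
  then show ?thesis by simp
qed

lemma g_Suc_rec: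
  assumes "1 \<le> r"
  shows "g (Suc r) n = delay 1 (g (Suc r)) n - numer_delay (g (Suc r)) n + numer_delay (g r) n"
proof -
  have "G (Suc r) - fps_X ^ 1 * G (Suc r) + numer * G (Suc r) = numer * G r"
    using G_Suc[OF assms] by (simp add: algebra_simps)
  then have "fps_nth (G (Suc r) - Abs_fps (delay 1 (g (Suc r))) + Abs_fps (numer_delay (g (Suc r)))) n =
     fps_nth (Abs_fps (numer_delay (g r))) n"
    unfolding fps_X_power_mult_Abs_fps numer_mult by simp
  then show ?thesis by simp
qed

end

section \<open>Generating functions and moments\<close>

text \<open>The operator \<open>X d/dX\<close> multiplies coefficient \<open>n\<close> by
  \<open>n\<close> and keeps the radius above 1; apply it \<open>j\<close> times.\<close>

lemma summable_norm_moments: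
  fixes f :: "complex fps"
  assumes "fps_conv_radius f > 1"
  shows "summable (\<lambda>n. real n ^ j * norm (fps_nth f n))"
  using assms
proof (induction j arbitrary: f)
  case 0
  have "ereal (norm (1::complex)) < fps_conv_radius f" using 0 by (simp add: one_ereal_def)
  from norm_summable_fps[OF this] show ?case by simp
next
  case (Suc j)
  have "fps_conv_radius (fps_X * fps_deriv f) \<ge> min (fps_conv_radius (fps_X :: complex fps)) (fps_conv_radius (fps_deriv f))"
    by (rule fps_conv_radius_mult)
  with Suc.prems fps_conv_radius_deriv[of f] have "fps_conv_radius (fps_X * fps_deriv f) > 1"
    by (auto simp: min_def intro: less_le_trans)
  from Suc.IH[OF this] have "summable (\<lambda>n. real n ^ j * norm (fps_nth (fps_X * fps_deriv f) n))" .
  moreover have "real n ^ j * norm (fps_nth (fps_X * fps_deriv f) n) = real n ^ Suc j * norm (fps_nth f n)" for n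
    by (cases n) (auto simp: norm_mult norm_of_nat simp del: of_nat_Suc)
  ultimately show ?case by (simp only:)
qed

lemma sums_delay_power:
  fixes f :: "nat \<Rightarrow> real" and t :: "'b::{real_normed_field}"
  assumes "(\<lambda>n. of_real (f n) * t ^ n) sums s"
  shows "(\<lambda>n. of_real (delay c f n) * t ^ n) sums (t ^ c * s)"
proof (rule sums_delay)
  show "(\<lambda>n. of_real (f n) * t ^ (n + c)) sums (t ^ c * s)"
    using sums_mult[OF assms, of "t ^ c"] by (simp add: power_add mult_ac)
qed

text \<open>Binomial expansion of the shifted argument \<open>(n + c) ^ j\<close>; this is where the
  binomial sums over lower moments come from.\<close>

lemma sums_delay_moment:
  fixes f :: "nat \<Rightarrow> real"
  assumes "\<And>k. k \<le> j \<Longrightarrow> (\<lambda>n. f n * real n ^ k) sums s k"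
  shows "(\<lambda>n. delay c f n * real n ^ j) sums (\<Sum>k\<le>j. real (j choose k) * s k * real c ^ (j - k))"
proof -
  have "(\<lambda>n. f n * real (n + c) ^ j) sums (\<Sum>k\<le>j. real (j choose k) * s k * real c ^ (j - k))"
  proof -
    have "(\<lambda>n. \<Sum>k\<le>j. real (j choose k) * real c ^ (j - k) * (f n * real n ^ k)) sums
       (\<Sum>k\<le>j. real (j choose k) * real c ^ (j - k) * s k)"
      by (intro sums_sum sums_mult assms) simp
    moreover have "(\<Sum>k\<le>j. real (j choose k) * real c ^ (j - k) * (f n * real n ^ k)) = f n * real (n + c) ^ j" for n
      unfolding of_nat_add binomial_ring sum_distrib_left by (intro sum.cong) (auto simp: mult_ac)
    ultimately show ?thesis by (simp add: mult_ac)
  qed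
  from sums_delay[where f = f and \<phi> = "\<lambda>n. real n ^ j" and 'b = real, of c, simplified, OF this[simplified]]
  show ?thesis by simp
qed

lemma collect_fixed_point:
  fixes x :: "'a::comm_ring_1"
  assumes "x = t * x - n * x + y"
  shows "(1 - t + n) * x = y"
proof -
  have "x - (t * x - n * x + y) = 0" using assms by (simp only: right_minus_eq)
  then have "(1 - t + n) * x - y = 0" by (simp only: algebra_simps mult_1)
  then show ?thesis by (simp only: right_minus_eq)
qed

locale pattern_distribution = pattern_recursion +
  assumes g_nonneg: "\<And>r n. 0 \<le> g r n" and g_summable: "\<And>r. summable (g r)"
begin

definition numerc :: "complex \<Rightarrow> complex" where
  "numerc t = of_real a * t ^ l * (1 - (of_real q * t) ^ m1) * (1 - (of_real p * t) ^ m2)"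

definition gen :: "nat \<Rightarrow> complex \<Rightarrow> complex" where
  "gen r t = (\<Sum>n. of_real (g r n) * t ^ n)"

lemma a_pos: "0 < a" using p_pos p_less_1 by (simp add: a_eq q_eq)

text \<open>Read off the recurrences: at level \<open>Suc r\<close> the terms of level
  \<open>r\<close> are delayed by at least \<open>l\<close>, and all other terms refer to earlier
  times. For \<open>r = 1\<close> the source starts at \<open>l + 1\<close>.\<close>

lemma g_zero:
  assumes "1 \<le> r" "n \<le> l * r"
  shows "g r n = 0"
  using assms
proof (induction r arbitrary: n rule: nat_induct_at_least)
  case base
  then show ?case
  proof (induction n)
    case 0
    then show ?case using l_eq l1_pos by (subst g_1_rec) (simp add: delay_def)
  next
    case (Suc n)
    \<comment> \<open>At time \<open>l\<close> the shift by \<open>l\<close> refers to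
      \<open>g 1 0\<close>, which also has to vanish.\<close>
    then show ?case using g_1_rec[of 0] l_eq l1_pos
      by (subst g_1_rec) (auto simp: delay_def le_Suc_eq)
  qed
next
  case (Suc r)
  have gr: "delay c (g r) n = 0" if "l \<le> c" "n \<le> l * Suc r" for c n
    using Suc.IH[of "n - c"] that by (auto simp: delay_def)
  have "l > 0" using l_eq l1_pos by simp
  from Suc.prems show ?case
  proof (induction n rule: less_induct)
    case (less n)
    have "delay c (g (Suc r)) n = 0" if "0 < c" for c
      using less.IH[of "n - c"] less.prems that by (auto simp: delay_def)
    then show ?case using \<open>l > 0\<close> gr[OF _ less.prems] Suc.hyps by (subst g_Suc_rec) simp_all
  qed
qed

lemma gen_sums:
  assumes "norm t \<le> 1"
  shows "(\<lambda>n. of_real (g r n) * t ^ n) sums gen r t"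
  unfolding gen_def
proof (rule summable_sums, rule summable_comparison_test'[OF g_summable[of r]])
  fix n assume "n \<ge> (0::nat)"
  show "norm (of_real (g r n) * t ^ n) \<le> g r n"
    using g_nonneg[of r n] power_le_one[of "norm t" n] assms
    by (simp add: norm_mult norm_power mult_left_le)
qed

lemma numer_delay_sums:
  assumes "(\<lambda>n. of_real (h n) * t ^ n) sums s"
  shows "(\<lambda>n. of_real (numer_delay h n) * t ^ n) sums (numerc t * s)"
proof -
  note d = sums_delay_power[OF assms]
  have "(\<lambda>n. of_real a * (of_real (delay l h n) * t ^ n - of_real (q ^ m1) * (of_real (delay (l + m1) h n) * t ^ n)
     - of_real (p ^ m2) * (of_real (delay (l + m2) h n) * t ^ n)
     + of_real (q ^ m1 * p ^ m2) * (of_real (delay (l + m1 + m2) h n) * t ^ n))) sums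
     (of_real a * (t ^ l * s - of_real (q ^ m1) * (t ^ (l + m1) * s) - of_real (p ^ m2) * (t ^ (l + m2) * s)
        + of_real (q ^ m1 * p ^ m2) * (t ^ (l + m1 + m2) * s)))"
    by (intro sums_mult sums_add sums_diff d)
  moreover have "of_real a * (t ^ l * s - of_real (q ^ m1) * (t ^ (l + m1) * s) - of_real (p ^ m2) * (t ^ (l + m2) * s)
        + of_real (q ^ m1 * p ^ m2) * (t ^ (l + m1 + m2) * s)) = numerc t * s"
    by (simp add: numerc_def power_add power_mult_distrib algebra_simps)
  ultimately show ?thesis by (simp add: algebra_simps)
qed

lemma trunc_geom_sums: "(\<lambda>n. of_real (trunc_geom n) * \<phi> n) sums (\<Sum>n<m2. of_real (p ^ n) * \<phi> n)"
  using sums_finite[of "{..<m2}" "\<lambda>n. of_real (trunc_geom n) * \<phi> n"] by (simp add: trunc_geom_def)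

text \<open>The recurrence is summed against \<open>t ^ n\<close>; the factor \<open>1 - p t\<close>
  closes the truncated geometric sum.\<close>

lemma gen_1_eq:
  assumes t: "norm t \<le> 1"
  shows "(1 - of_real p * t) * ((1 - t + numerc t) * gen 1 t) = of_real q * t * numerc t"
proof -
  let ?e = "\<Sum>n<m2. of_real (p ^ n) * t ^ n"
  note d = sums_delay_power[OF gen_sums[OF t, of 1], of 1] numer_delay_sums[OF gen_sums[OF t, of 1]]
    sums_delay_power[OF trunc_geom_sums[of "\<lambda>n. t ^ n"]]
  have S: "(\<lambda>n. of_real (delay 1 (g 1) n) * t ^ n - of_real (numer_delay (g 1) n) * t ^ n
      + of_real (q * a) * (of_real (delay (l + 1) trunc_geom n) * t ^ n -
          of_real (q ^ m1) * (of_real (delay (l + 1 + m1) trunc_geom n) * t ^ n))) sums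
     (t ^ 1 * gen 1 t - numerc t * gen 1 t
      + of_real (q * a) * (t ^ (l + 1) * ?e - of_real (q ^ m1) * (t ^ (l + 1 + m1) * ?e)))"
    by (intro sums_mult sums_add sums_diff d)
  have eq: "(\<lambda>n. of_real (delay 1 (g 1) n) * t ^ n - of_real (numer_delay (g 1) n) * t ^ n
      + of_real (q * a) * (of_real (delay (l + 1) trunc_geom n) * t ^ n -
          of_real (q ^ m1) * (of_real (delay (l + 1 + m1) trunc_geom n) * t ^ n))) =
     (\<lambda>n. of_real (g 1 n) * t ^ n)"
    unfolding arg_cong[OF g_1_rec, of complex_of_real] by (intro ext) (simp add: algebra_simps)
  have gen1: "gen 1 t = t ^ 1 * gen 1 t - numerc t * gen 1 t
      + of_real (q * a) * (t ^ (l + 1) * ?e - of_real (q ^ m1) * (t ^ (l + 1 + m1) * ?e))"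
    by (rule sums_unique2[OF gen_sums[OF t, of 1] S[unfolded eq]])
  have e: "(1 - of_real p * t) * ?e = 1 - (of_real p * t) ^ m2"
    using one_diff_power_eq[of "of_real p * t" m2] by (simp add: power_mult_distrib)
  have "(1 - t + numerc t) * gen 1 t =
     of_real (q * a) * (t ^ (l + 1) * ?e - of_real (q ^ m1) * (t ^ (l + 1 + m1) * ?e))"
    by (rule collect_fixed_point[OF gen1[unfolded power_one_right[of t]]])
  also have "\<dots> = of_real (q * a) * t ^ (l + 1) * (1 - (of_real q * t) ^ m1) * ?e"
    by (simp add: power_add power_mult_distrib algebra_simps)
  finally have "(1 - of_real p * t) * ((1 - t + numerc t) * gen 1 t) =
    of_real (q * a) * t ^ (l + 1) * (1 - (of_real q * t) ^ m1) * ((1 - of_real p * t) * ?e)"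
    by (simp only: mult_ac)
  then show ?thesis unfolding e numerc_def of_real_mult power_add power_one_right by (simp only: mult_ac)
qed

lemma gen_Suc_eq:
  assumes t: "norm t \<le> 1" and r: "1 \<le> r"
  shows "(1 - t + numerc t) * gen (Suc r) t = numerc t * gen r t"
proof -
  note d = sums_delay_power[OF gen_sums[OF t, of "Suc r"], of 1] numer_delay_sums[OF gen_sums[OF t, of "Suc r"]]
    numer_delay_sums[OF gen_sums[OF t, of r]]
  have S: "(\<lambda>n. of_real (delay 1 (g (Suc r)) n) * t ^ n - of_real (numer_delay (g (Suc r)) n) * t ^ n
      + of_real (numer_delay (g r) n) * t ^ n) sums
     (t ^ 1 * gen (Suc r) t - numerc t * gen (Suc r) t + numerc t * gen r t)"
    by (intro sums_add sums_diff d)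
  have eq: "(\<lambda>n. of_real (delay 1 (g (Suc r)) n) * t ^ n - of_real (numer_delay (g (Suc r)) n) * t ^ n
      + of_real (numer_delay (g r) n) * t ^ n) = (\<lambda>n. of_real (g (Suc r) n) * t ^ n)"
    unfolding left_diff_distrib[symmetric] distrib_right[symmetric] of_real_diff[symmetric] of_real_add[symmetric]
      g_Suc_rec[OF r, symmetric] ..
  have "gen (Suc r) t = t ^ 1 * gen (Suc r) t - numerc t * gen (Suc r) t + numerc t * gen r t"
    by (rule sums_unique2[OF gen_sums[OF t, of "Suc r"] S[unfolded eq]])
  from collect_fixed_point[OF this[unfolded power_one_right[of t]]] show ?thesis .
qed

lemma one_minus_pt_nonzero:
  assumes "norm t \<le> 1"
  shows "1 - of_real p * t \<noteq> (0 :: complex)"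
proof
  assume "1 - of_real p * t = 0"
  then have "norm (of_real p * t) = 1" by (metis eq_iff_diff_eq_0 norm_one)
  moreover have "norm (of_real p * t) \<le> p"
    using assms p_pos by (simp add: norm_mult mult_left_le)
  ultimately show False using p_less_1 by simp
qed

text \<open>
  A zero of the denominator with \<open>norm t \<le> 1\<close> would force \<open>t * numerc t = t * (t - 1)\<close> to
  vanish, because \<open>gen 1 t\<close> is finite; but neither \<open>0\<close> nor \<open>1\<close> is a zero.
\<close>

lemma denom_nonzero:
  assumes t: "norm t \<le> 1"
  shows "1 - t + numerc t \<noteq> 0"
proof
  assume z: "1 - t + numerc t = 0"
  then have N: "numerc t = t - 1" by (simp add: algebra_simps eq_neg_iff_add_eq_0)
  from gen_1_eq[OF t] z have "of_real q * t * numerc t = 0" by simp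
  then have "t = 0 \<or> t = 1" using N p_less_1 by (auto simp: q_eq)
  then show False
  proof
    assume "t = 0"
    moreover have "l \<noteq> 0" using l_eq l1_pos by simp
    ultimately show False using z by (simp add: numerc_def zero_power)
  next
    assume t1: "t = 1"
    have "p ^ m2 < 1" "q ^ m1 < 1"
      unfolding m1_eq m2_eq q_eq
      using p_pos p_less_1 power_Suc_less_one[of p] power_Suc_less_one[of "1 - p"]
      by (simp_all del: power_Suc)
    then have "a * (1 - q ^ m1) * (1 - p ^ m2) \<noteq> 0" using a_pos by simp
    moreover have "numerc t = of_real (a * (1 - q ^ m1) * (1 - p ^ m2))"
      unfolding t1 numerc_def by simp
    ultimately show False using N t1 by (metis diff_self of_real_eq_0_iff)
  qed
qed

lemma gen_closed_form:
  assumes t: "norm t \<le> 1" and r: "1 \<le> r"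
  shows "gen r t = of_real q * t / (1 - of_real p * t) * (numerc t / (1 - t + numerc t)) ^ r"
  using r
proof (induction r rule: nat_induct_at_least)
  case base
  have "x = c / u * (n / v)" if "u * (v * x) = c * n" "u \<noteq> 0" "v \<noteq> 0" for x c u n v :: complex
    using that by (simp add: field_simps)
  from this[OF gen_1_eq[OF t] one_minus_pt_nonzero[OF t] denom_nonzero[OF t]] show ?case by simp
next
  case (Suc r)
  have "gen (Suc r) t = numerc t / (1 - t + numerc t) * gen r t"
    using gen_Suc_eq[OF t Suc.hyps] denom_nonzero[OF t] by (simp add: field_simps)
  then show ?case unfolding Suc.IH power_Suc by (simp only: mult_ac)
qed

text \<open>At \<open>t = 1\<close> the fraction reduces to \<open>numerc 1 / numerc 1\<close> and
  the prefactor to \<open>q / (1 - p)\<close>. This yields that the waiting time is almost surely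
  finite.\<close>

lemma g_sums_1:
  assumes "1 \<le> r"
  shows "g r sums 1"
proof -
  have "numerc 1 \<noteq> 0" using denom_nonzero[of 1] by simp
  moreover have "complex_of_real q = 1 - of_real p" by (simp add: q_eq)
  ultimately have "gen r 1 = 1"
    using gen_closed_form[of 1 r] one_minus_pt_nonzero[of 1] assms by simp
  then have "(\<lambda>n. complex_of_real (g r n)) sums of_real 1"
    using gen_sums[of 1 r] by simp
  then show ?thesis by (simp only: sums_of_real_iff)
qed

section \<open>Convergence beyond the unit disc\<close>

definition denom_poly :: "complex poly" where
  "denom_poly = 1 - monom 1 1 + (monom (of_real a) l - monom (of_real (a * q ^ m1)) (l + m1)
     - monom (of_real (a * p ^ m2)) (l + m2) + monom (of_real (a * q ^ m1 * p ^ m2)) (l + m1 + m2))"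

lemma poly_denom_poly: "poly denom_poly t = 1 - t + numerc t"
  unfolding denom_poly_def numerc_def
  by (simp add: poly_monom power_add power_mult_distrib algebra_simps)

text \<open>Non-vanishing is an open condition, and compactness of the closed disc gives it a
  uniform margin.\<close>

lemma denom_nonzero_neighbourhood:
  obtains R where "1 < R" "\<And>t. norm t < R \<Longrightarrow> poly denom_poly t \<noteq> 0"
proof -
  have "open {t. poly denom_poly t \<noteq> 0}"
    by (intro open_Collect_neq continuous_intros)
  moreover have "cball 0 1 \<subseteq> {t. poly denom_poly t \<noteq> 0}"
    using denom_nonzero by (auto simp: poly_denom_poly)
  ultimately obtain e where e: "e > 0" "(\<Union>x\<in>cball 0 1. ball x e) \<subseteq> {t. poly denom_poly t \<noteq> 0}"
    using compact_subset_open_imp_ball_epsilon_subset[OF compact_cball] by metis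
  have "poly denom_poly t \<noteq> 0" if "norm t < 1 + e" for t
  proof (cases "norm t \<le> 1")
    case True
    then show ?thesis using denom_nonzero by (simp add: poly_denom_poly)
  next
    case False
    \<comment> \<open>The radial projection \<open>sgn t\<close> lies on the unit circle at distance
      \<open>norm t - 1\<close> from \<open>t\<close>.\<close>
    have "t \<noteq> 0" using False by auto
    then have "t - sgn t = (norm t - 1) *\<^sub>R sgn t"
      by (simp add: sgn_div_norm algebra_simps)
    then have "norm (t - sgn t) = norm t - 1"
      using False \<open>t \<noteq> 0\<close> by (simp add: norm_sgn)
    then have "t \<in> ball (sgn t) e" using that by (simp add: dist_norm norm_minus_commute)
    moreover have "sgn t \<in> cball 0 1" by (simp add: norm_sgn)
    ultimately show ?thesis using e(2) by blast
  qed
  with e(1) show ?thesis by (intro that[of "1 + e"]) auto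
qed

abbreviation "Gc r \<equiv> Abs_fps (\<lambda>n. complex_of_real (g r n))"

lemma fps_of_poly_mult_Gc:
  "fps_of_poly (monom c k) * Gc r = fps_const c * Abs_fps (\<lambda>n. of_real (delay k (g r) n))"
  unfolding fps_of_poly_monom mult.assoc fps_X_power_mult_Abs_fps
  by (intro fps_ext) (simp add: delay_def)

text \<open>The denominator has constant term 1 and no zero within radius \<open>R\<close>, so its
  inverse converges there. Dividing by it transfers the radius from a polynomial to
  \<open>G 1\<close>, then from each level to the next.\<close>

lemma conv_radius_g: "1 \<le> r \<Longrightarrow> fps_conv_radius (Gc r) > 1"
proof -
  obtain R where R: "1 < R" "\<And>t. norm t < R \<Longrightarrow> poly denom_poly t \<noteq> 0"
    using denom_nonzero_neighbourhood by blast
  let ?U = "fps_of_poly denom_poly"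
  let ?N = "fps_of_poly (denom_poly - (1 - monom 1 1))"
  let ?b = "Abs_fps (\<lambda>n. complex_of_real (q * a * (delay (l + 1) trunc_geom n - q ^ m1 * delay (l + 1 + m1) trunc_geom n)))"
  have "l \<noteq> 0" using l_eq l1_pos by simp
  then have U0: "fps_nth ?U 0 = 1" by (simp add: denom_poly_def coeff_monom)
  have inv: "fps_conv_radius (inverse ?U) \<ge> R"
    using fps_conv_radius_inverse[of R ?U] R U0 by (simp add: eball_def)
  have solve: "fps_conv_radius x \<ge> R" if "?U * x = y" "fps_conv_radius y \<ge> R" for x y
  proof -
    have "x = inverse ?U * y"
      using that(1) inverse_mult_eq_1[of ?U] U0 by (metis mult.assoc mult_1 zero_neq_one)
    then show ?thesis using fps_conv_radius_mult[of "inverse ?U" y] inv that(2)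
      by (metis (no_types, lifting) min.bounded_iff order_trans)
  qed
  have N: "?N * Gc r = Abs_fps (\<lambda>n. of_real (numer_delay (g r) n))" for r
  proof -
    have "?N * Gc r = fps_of_poly (monom (of_real a) l) * Gc r
       - fps_of_poly (monom (of_real (a * q ^ m1)) (l + m1)) * Gc r
       - fps_of_poly (monom (of_real (a * p ^ m2)) (l + m2)) * Gc r
       + fps_of_poly (monom (of_real (a * q ^ m1 * p ^ m2)) (l + m1 + m2)) * Gc r"
      by (simp add: denom_poly_def fps_of_poly_add fps_of_poly_diff algebra_simps)
    also have "\<dots> = Abs_fps (\<lambda>n. of_real (numer_delay (g r) n))"
      unfolding fps_of_poly_mult_Gc by (intro fps_ext) (simp add: algebra_simps)
    finally show ?thesis .
  qed
  have U: "?U * Gc r = Gc r - Abs_fps (\<lambda>n. of_real (delay 1 (g r) n)) + ?N * Gc r" for r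
  proof -
    have "?U = 1 - fps_of_poly (monom 1 1) + ?N" by (simp add: fps_of_poly_diff)
    then have "?U * Gc r = Gc r - fps_of_poly (monom 1 1) * Gc r + ?N * Gc r"
      by (simp only: left_diff_distrib distrib_right mult_1)
    then show ?thesis unfolding fps_of_poly_mult_Gc by simp
  qed
  have "R \<le> fps_conv_radius (Gc r)" if "1 \<le> r"
    using that
  proof (induction r rule: nat_induct_at_least)
    case base
    have b: "?U * Gc 1 = ?b"
    proof -
      have "?U * Gc 1 = Gc 1 - Abs_fps (\<lambda>n. of_real (delay 1 (g 1) n)) + Abs_fps (\<lambda>n. of_real (numer_delay (g 1) n))"
        by (simp only: U N)
      also have "\<dots> = ?b"
      proof (rule fps_ext)
        fix n
        show "fps_nth (Gc 1 - Abs_fps (\<lambda>n. of_real (delay 1 (g 1) n)) + Abs_fps (\<lambda>n. of_real (numer_delay (g 1) n))) n = fps_nth ?b n"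
          using arg_cong[OF g_1_rec[of n], of complex_of_real] by (simp add: algebra_simps)
      qed
      finally show ?thesis .
    qed
    \<comment> \<open>The series \<open>?b\<close> has finitely many nonzero coefficients, hence the
      infinite radius of the zero series.\<close>
    have "fps_conv_radius ?b = fps_conv_radius (0 :: complex fps)"
      unfolding fps_conv_radius_def
    proof (rule conv_radius_cong')
      show "eventually (\<lambda>n. fps_nth ?b n = fps_nth 0 n) sequentially"
        unfolding eventually_sequentially
        by (intro exI[of _ "l + 1 + m1 + m2"]) (auto simp: delay_def trunc_geom_def)
    qed
    then have "R \<le> fps_conv_radius ?b" by (simp only: fps_conv_radius_0 ereal_less_eq)
    then show ?case by (rule solve[OF b])
  next
    case (Suc r)
    have "?U * Gc (Suc r) = ?N * Gc r"
    proof -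
      have "?U * Gc (Suc r) = Gc (Suc r) - Abs_fps (\<lambda>n. of_real (delay 1 (g (Suc r)) n))
          + Abs_fps (\<lambda>n. of_real (numer_delay (g (Suc r)) n))"
        by (simp only: U N)
      also have "\<dots> = Abs_fps (\<lambda>n. of_real (numer_delay (g r) n))"
      proof (rule fps_ext)
        fix n
        show "fps_nth (Gc (Suc r) - Abs_fps (\<lambda>n. of_real (delay 1 (g (Suc r)) n))
            + Abs_fps (\<lambda>n. of_real (numer_delay (g (Suc r)) n))) n =
            fps_nth (Abs_fps (\<lambda>n. complex_of_real (numer_delay (g r) n))) n"
          using arg_cong[OF g_Suc_rec[OF Suc.hyps, of n], of complex_of_real] by (simp add: algebra_simps)
      qed
      finally show ?thesis by (simp only: N)
    qed
    moreover have "fps_conv_radius (?N * Gc r) \<ge> R"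
      using fps_conv_radius_mult[of ?N "Gc r"] Suc.IH by simp
    ultimately show ?case by (rule solve)
  qed
  moreover have "1 < ereal R" using R by (simp add: one_ereal_def)
  ultimately show "1 \<le> r \<Longrightarrow> fps_conv_radius (Gc r) > 1" by (metis less_le_trans)
qed

section \<open>Recurrences for the moments\<close>

definition mom :: "nat \<Rightarrow> nat \<Rightarrow> real" where
  "mom r j = (\<Sum>n. g r n * real n ^ j)"

lemma mom_sums:
  assumes "1 \<le> r"
  shows "(\<lambda>n. g r n * real n ^ j) sums mom r j"
  unfolding mom_def
  using summable_norm_moments[OF conv_radius_g[OF assms], of j] g_nonneg
  by (intro summable_sums) (simp add: mult.commute)

abbreviation numer_moment :: "nat \<Rightarrow> nat \<Rightarrow> real" where
  "numer_moment j k \<equiv> a * (real l ^ (j - k) - q ^ m1 * real (l + m1) ^ (j - k)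
     - p ^ m2 * real (l + m2) ^ (j - k) + q ^ m1 * p ^ m2 * real (l + m1 + m2) ^ (j - k))"

lemma delay_moment_sums:
  "1 \<le> r \<Longrightarrow> (\<lambda>n. delay c (g r) n * real n ^ j) sums
    (\<Sum>k\<le>j. real (j choose k) * mom r k * real c ^ (j - k))"
  by (rule sums_delay_moment) (rule mom_sums)

lemma numer_delay_moment_sums:
  assumes r: "1 \<le> r"
  shows "(\<lambda>n. numer_delay (g r) n * real n ^ j) sums
    (\<Sum>k\<le>j. real (j choose k) * mom r k * numer_moment j k)"
proof -
  let ?S = "\<lambda>c. \<Sum>k\<le>j. real (j choose k) * mom r k * real c ^ (j - k)"
  note d = delay_moment_sums[OF r]
  have "(\<lambda>n. a * (delay l (g r) n * real n ^ j - q ^ m1 * (delay (l + m1) (g r) n * real n ^ j)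
     - p ^ m2 * (delay (l + m2) (g r) n * real n ^ j)
     + q ^ m1 * p ^ m2 * (delay (l + m1 + m2) (g r) n * real n ^ j))) sums
     (a * (?S l - q ^ m1 * ?S (l + m1) - p ^ m2 * ?S (l + m2) + q ^ m1 * p ^ m2 * ?S (l + m1 + m2)))"
    by (intro sums_mult sums_add sums_diff d)
  moreover have "a * (?S l - q ^ m1 * ?S (l + m1) - p ^ m2 * ?S (l + m2) + q ^ m1 * p ^ m2 * ?S (l + m1 + m2)) =
     (\<Sum>k\<le>j. real (j choose k) * mom r k * numer_moment j k)"
    unfolding sum_distrib_left sum_subtractf[symmetric] sum.distrib[symmetric]
    by (intro sum.cong refl) (simp add: algebra_simps)
  moreover have "a * (delay l (g r) n * real n ^ j - q ^ m1 * (delay (l + m1) (g r) n * real n ^ j)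
     - p ^ m2 * (delay (l + m2) (g r) n * real n ^ j)
     + q ^ m1 * p ^ m2 * (delay (l + m1 + m2) (g r) n * real n ^ j)) = numer_delay (g r) n * real n ^ j" for n
    by (simp add: algebra_simps)
  ultimately show ?thesis by simp
qed

text \<open>The coefficient recurrence is summed against \<open>n ^ j\<close>. The relation is
  implicit: for \<open>k = j\<close> the right-hand side contains \<open>mom (Suc r) j\<close>
  itself.\<close>

lemma mom_Suc:
  assumes r: "1 \<le> r"
  shows "mom (Suc r) j = (\<Sum>k\<le>j. real (j choose k) *
    (mom (Suc r) k + numer_moment j k * (mom r k - mom (Suc r) k)))"
proof -
  have r': "1 \<le> Suc r" by simp
  note d = delay_moment_sums[OF r'] numer_delay_moment_sums[OF r', of j]
    numer_delay_moment_sums[OF r, of j]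
  have S: "(\<lambda>n. delay 1 (g (Suc r)) n * real n ^ j - numer_delay (g (Suc r)) n * real n ^ j
     + numer_delay (g r) n * real n ^ j) sums
     ((\<Sum>k\<le>j. real (j choose k) * mom (Suc r) k * real 1 ^ (j - k))
      - (\<Sum>k\<le>j. real (j choose k) * mom (Suc r) k * numer_moment j k)
      + (\<Sum>k\<le>j. real (j choose k) * mom r k * numer_moment j k))"
    by (intro sums_add sums_diff d)
  have eq: "(\<lambda>n. delay 1 (g (Suc r)) n * real n ^ j - numer_delay (g (Suc r)) n * real n ^ j
     + numer_delay (g r) n * real n ^ j) = (\<lambda>n. g (Suc r) n * real n ^ j)"
    unfolding left_diff_distrib[symmetric] distrib_right[symmetric] g_Suc_rec[OF r, symmetric] ..
  have "mom (Suc r) j = (\<Sum>k\<le>j. real (j choose k) * mom (Suc r) k * real 1 ^ (j - k))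
      - (\<Sum>k\<le>j. real (j choose k) * mom (Suc r) k * numer_moment j k)
      + (\<Sum>k\<le>j. real (j choose k) * mom r k * numer_moment j k)"
    by (rule sums_unique2[OF mom_sums[OF r'] S[unfolded eq]])
  also have "\<dots> = (\<Sum>k\<le>j. real (j choose k) *
    (mom (Suc r) k + numer_moment j k * (mom r k - mom (Suc r) k)))"
    unfolding sum_subtractf[symmetric] sum.distrib[symmetric]
    by (intro sum.cong refl) (simp add: algebra_simps)
  finally show ?thesis .
qed

lemma mom_1:
  "mom 1 j = (\<Sum>k\<le>j. real (j choose k) * mom 1 k * (1 - numer_moment j k)) + q * a *
    ((\<Sum>n<m2. p ^ n * real (n + (l + 1)) ^ j) - q ^ m1 * (\<Sum>n<m2. p ^ n * real (n + (l + 1 + m1)) ^ j))"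
proof -
  have e: "(\<lambda>n. delay c trunc_geom n * real n ^ j) sums (\<Sum>n<m2. p ^ n * real (n + c) ^ j)" for c
    using sums_delay[where f = trunc_geom and \<phi> = "\<lambda>n. real n ^ j" and 'b = real and c = c,
        OF trunc_geom_sums] by (simp only: of_real_eq_id id_apply)
  note d = delay_moment_sums[of 1, OF order_refl]
    numer_delay_moment_sums[of 1 j, OF order_refl] e
  have S: "(\<lambda>n. delay 1 (g 1) n * real n ^ j - numer_delay (g 1) n * real n ^ j
     + q * a * (delay (l + 1) trunc_geom n * real n ^ j - q ^ m1 * (delay (l + 1 + m1) trunc_geom n * real n ^ j))) sums
     ((\<Sum>k\<le>j. real (j choose k) * mom 1 k * real 1 ^ (j - k))
      - (\<Sum>k\<le>j. real (j choose k) * mom 1 k * numer_moment j k)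
      + q * a * ((\<Sum>n<m2. p ^ n * real (n + (l + 1)) ^ j) - q ^ m1 * (\<Sum>n<m2. p ^ n * real (n + (l + 1 + m1)) ^ j)))"
    by (intro sums_mult sums_add sums_diff d)
  have eq: "delay 1 (g 1) n * real n ^ j - numer_delay (g 1) n * real n ^ j
     + q * a * (delay (l + 1) trunc_geom n * real n ^ j - q ^ m1 * (delay (l + 1 + m1) trunc_geom n * real n ^ j)) =
     g 1 n * real n ^ j" for n
    unfolding arg_cong[OF g_1_rec[of n], of "\<lambda>x. x * real n ^ j"] by (simp add: algebra_simps)
  have "mom 1 j = (\<Sum>k\<le>j. real (j choose k) * mom 1 k * real 1 ^ (j - k))
      - (\<Sum>k\<le>j. real (j choose k) * mom 1 k * numer_moment j k)
      + q * a * ((\<Sum>n<m2. p ^ n * real (n + (l + 1)) ^ j) - q ^ m1 * (\<Sum>n<m2. p ^ n * real (n + (l + 1 + m1)) ^ j))"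
    by (rule sums_unique2[OF mom_sums[of 1 j, OF order_refl] S[unfolded eq]])
  moreover have "(\<Sum>k\<le>j. real (j choose k) * mom 1 k * real 1 ^ (j - k))
      - (\<Sum>k\<le>j. real (j choose k) * mom 1 k * numer_moment j k) =
     (\<Sum>k\<le>j. real (j choose k) * mom 1 k * (1 - numer_moment j k))"
    unfolding sum_subtractf[symmetric] by (intro sum.cong refl) (simp add: algebra_simps)
  ultimately show ?thesis by (simp only:)
qed

end

section \<open>Waiting times\<close>

lemma (in prob_space) point_events_sums:
  fixes X :: "'a \<Rightarrow> enat"
  assumes X: "\<And>m. {\<omega> \<in> space M. X \<omega> = enat m} \<in> events"
  shows "(\<lambda>m. prob {\<omega> \<in> space M. X \<omega> = enat m}) sums prob {\<omega> \<in> space M. X \<omega> \<noteq> \<infinity>}"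
proof -
  have "(\<Union>m. {\<omega> \<in> space M. X \<omega> = enat m}) = {\<omega> \<in> space M. X \<omega> \<noteq> \<infinity>}"
    by auto
  moreover have "(\<lambda>m. prob {\<omega> \<in> space M. X \<omega> = enat m}) sums
      prob (\<Union>m. {\<omega> \<in> space M. X \<omega> = enat m})"
    by (rule finite_measure_UNION) (use X in \<open>auto simp: disjoint_family_on_def\<close>)
  ultimately show ?thesis by simp
qed

text \<open>The integrand is split over the values of \<open>X\<close>. On each path at most one
  term is nonzero, none if \<open>X\<close> is infinite, in line with \<open>enat_pow\<close>; the
  point probabilities dominate the norms.\<close>

lemma (in prob_space) pgf_sums:
  fixes X :: "'a \<Rightarrow> enat"
  assumes X: "\<And>m. {\<omega> \<in> space M. X \<omega> = enat m} \<in> events" and t: "norm t \<le> 1"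
  shows "(\<lambda>m. of_real (prob {\<omega> \<in> space M. X \<omega> = enat m}) * t ^ m) sums pgf M X t"
proof -
  define A where "A m = {\<omega> \<in> space M. X \<omega> = enat m}" for m
  define h where "h m \<omega> = indicator (A m) \<omega> *\<^sub>R t ^ m" for m \<omega>
  have A: "A m \<in> events" for m using X by (simp add: A_def)
  have int: "integral\<^sup>L M (h m) = of_real (prob (A m)) * t ^ m" and intble: "integrable M (h m)"
    and intn: "integral\<^sup>L M (\<lambda>\<omega>. norm (h m \<omega>)) = prob (A m) * norm t ^ m" for m
    using A[of m] unfolding h_def
    by (simp_all add: norm_power scaleR_conv_of_real[of "prob (A m)"] less_top[symmetric])
  have h0: "h m \<omega> = 0" if "X \<omega> \<noteq> enat m" for m \<omega>
    using that by (simp add: h_def A_def)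
  have sum_h: "(\<lambda>m. h m \<omega>) sums enat_pow t (X \<omega>)" if "\<omega> \<in> space M" for \<omega>
  proof (cases "X \<omega>")
    case (enat k)
    then have "(\<lambda>m. h m \<omega>) = (\<lambda>m. if m = k then t ^ k else 0)"
      using that by (auto simp: h_def A_def)
    then show ?thesis using sums_single[of k "\<lambda>m. t ^ m"] enat
      by (simp add: enat_pow_def cong: if_cong)
  next
    case infinity
    then show ?thesis using h0[of \<omega>] by (simp add: enat_pow_def)
  qed
  have "(\<lambda>m. integral\<^sup>L M (h m)) sums (\<integral>\<omega>. (\<Sum>m. h m \<omega>) \<partial>M)"
  proof (rule sums_integral)
    show "AE \<omega> in M. summable (\<lambda>m. norm (h m \<omega>))"
    proof (rule AE_I2)
      fix \<omega>
      show "summable (\<lambda>m. norm (h m \<omega>))"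
        using h0[of \<omega>] by (intro summable_finite[of "{m. X \<omega> = enat m}"])
          (auto intro: finite_subset[of _ "{the_enat (X \<omega>)}"])
    qed
    have "summable (\<lambda>m. prob (A m))"
      using point_events_sums[OF X] unfolding A_def by (rule sums_summable)
    moreover have "norm (prob (A m) * norm t ^ m) \<le> prob (A m)" for m
      using t by (simp add: power_le_one mult_left_le)
    ultimately show "summable (\<lambda>m. integral\<^sup>L M (\<lambda>\<omega>. norm (h m \<omega>)))"
      unfolding intn by (rule summable_comparison_test'[where N = 0])
  qed (rule intble)
  moreover have "(\<integral>\<omega>. (\<Sum>m. h m \<omega>) \<partial>M) = pgf M X t"
    unfolding pgf_def by (intro Bochner_Integration.integral_cong refl) (simp add: sums_unique[OF sum_h])
  ultimately show ?thesis unfolding int by (simp add: A_def)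
qed

text \<open>Monotone convergence over the values of \<open>X\<close>. Where \<open>X\<close> is
  infinite the indicator sum is 0 while the power is positive, so such paths must form a null
  set.\<close>

lemma (in prob_space) moment_eq_suminf:
  fixes X :: "'a \<Rightarrow> enat"
  assumes X: "\<And>m. {\<omega> \<in> space M. X \<omega> = enat m} \<in> events" and fin: "AE \<omega> in M. X \<omega> \<noteq> \<infinity>"
    and S: "(\<lambda>m. prob {\<omega> \<in> space M. X \<omega> = enat m} * real m ^ j) sums s"
  shows "moment M X j = ennreal s"
proof -
  define A where "A m = {\<omega> \<in> space M. X \<omega> = enat m}" for m
  have A: "A m \<in> events" for m using X by (simp add: A_def)
  have "moment M X j = (\<integral>\<^sup>+ \<omega>. (\<Sum>m. ennreal (real m ^ j) * indicator (A m) \<omega>) \<partial>M)"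
    unfolding moment_def
  proof (rule nn_integral_cong_AE)
    show "AE \<omega> in M. ennreal_of_enat (X \<omega>) ^ j = (\<Sum>m. ennreal (real m ^ j) * indicator (A m) \<omega>)"
      using fin AE_space
    proof eventually_elim
      case (elim \<omega>)
      then obtain k where k: "X \<omega> = enat k" by auto
      have "(\<Sum>m. ennreal (real m ^ j) * indicator (A m) \<omega>) =
         (\<Sum>m\<in>{k}. ennreal (real m ^ j) * indicator (A m) \<omega>)"
        using k by (intro suminf_finite) (auto simp: A_def)
      then show ?case using k elim
        by (simp add: A_def ennreal_of_nat_eq_real_of_nat ennreal_power)
    qed
  qed
  also have "\<dots> = (\<Sum>m. \<integral>\<^sup>+ \<omega>. ennreal (real m ^ j) * indicator (A m) \<omega> \<partial>M)"
    using A by (intro nn_integral_suminf) auto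
  also have "\<dots> = (\<Sum>m. ennreal (prob (A m) * real m ^ j))"
  proof (intro arg_cong[where f = suminf] ext)
    fix m
    show "(\<integral>\<^sup>+ \<omega>. ennreal (real m ^ j) * indicator (A m) \<omega> \<partial>M) = ennreal (prob (A m) * real m ^ j)"
      unfolding nn_integral_cmult_indicator[OF A] emeasure_eq_measure
      by (subst mult.commute) (simp add: ennreal_mult)
  qed
  also have "\<dots> = ennreal s"
    using S unfolding A_def[symmetric]
    by (subst suminf_ennreal2) (auto simp: sums_iff)
  finally show ?thesis .
qed

context pattern_trials
begin

text \<open>As for a stopping time, the event is decided by the counts up to \<open>m\<close>, hence
  by the first \<open>m\<close> trials.\<close>

lemma waiting_time_events: "{\<omega> \<in> space M. waiting_time l1 k1 l2 k2 r (path \<omega>) = enat m} \<in> events"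
  unfolding waiting_time_eq_enat_iff[OF l1_pos l2_pos]
proof (rule determined_by_sets)
  show "determined_by m (\<lambda>x. cnt m x = r \<and> (\<forall>n<m. cnt n x \<noteq> r))"
    unfolding determined_by_def
  proof (intro allI impI)
    fix x y :: "nat \<Rightarrow> nat" assume A: "\<forall>u\<in>{1..m}. x u = y u"
    have "cnt n x = cnt n y" if "n \<le> m" for n
      using A that by (intro pattern_count_cong l1_pos l2_pos) auto
    then show "(cnt m x = r \<and> (\<forall>n<m. cnt n x \<noteq> r)) = (cnt m y = r \<and> (\<forall>n<m. cnt n y \<noteq> r))"
      by auto
  qed
qed

lemma summable_wait_prob: "summable (wait_prob r)"
  using point_events_sums[OF waiting_time_events] unfolding wait_prob_def by (rule sums_summable)

lemma wait_prob_0: "wait_prob 0 n = of_bool (n = 0)"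
  unfolding wait_prob_def by (auto simp: waiting_time_zero[OF l1_pos l2_pos] prob_space)

lemma point_prob_waiting_time:
  "point_prob M (\<lambda>\<omega>. waiting_time l1 k1 l2 k2 r (path \<omega>)) m = (if m < 0 then 0 else wait_prob r (nat m))"
  by (simp add: point_prob_def wait_prob_def)

lemma point_prob_delay:
  "point_prob M (\<lambda>\<omega>. waiting_time l1 k1 l2 k2 r (path \<omega>)) (int n - int c) = delay c (wait_prob r) n"
  by (auto simp: point_prob_waiting_time delay_def nat_diff_distrib')

end

section \<open>Source terms of the first waiting time, rewritten with \<open>q / p\<close>\<close>

context pattern_distribution
begin

text \<open>The exponent of \<open>p\<close> in the second term is smaller by \<open>m1\<close>;
  extracting the common power turns \<open>q ^ m1\<close> into \<open>(q / p) ^ m1\<close>.\<close>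

lemma trunc_geom_delay_terms:
  assumes "l + 1 \<le> n"
  shows "delay (l + 1) trunc_geom n - q ^ m1 * delay (l + 1 + m1) trunc_geom n =
    p powi (int n - int l - 1) * (of_bool (int l + 1 \<le> int n \<and> int n \<le> int l + int m2)
      - (q / p) ^ m1 * of_bool (int l + int m1 + 1 \<le> int n \<and> int n \<le> int l + int m1 + int m2))"
proof -
  have "int n - int l - 1 = int (n - (l + 1))" using assms by simp
  then have pw: "p powi (int n - int l - 1) = p ^ (n - (l + 1))" by (simp only: power_int_of_nat)
  have 1: "delay (l + 1) trunc_geom n = p ^ (n - (l + 1)) * of_bool (int l + 1 \<le> int n \<and> int n \<le> int l + int m2)"
    using assms by (auto simp: delay_def trunc_geom_def of_bool_def)
  have 2: "q ^ m1 * delay (l + 1 + m1) trunc_geom n = p ^ (n - (l + 1)) * ((q / p) ^ m1 *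
     of_bool (int l + int m1 + 1 \<le> int n \<and> int n \<le> int l + int m1 + int m2))"
  proof (cases "l + 1 + m1 \<le> n")
    case True
    then have "p ^ (n - (l + 1)) = p ^ (n - (l + 1 + m1)) * p ^ m1" by (simp flip: power_add)
    then have "q ^ m1 * p ^ (n - (l + 1 + m1)) = p ^ (n - (l + 1)) * (q / p) ^ m1"
      using p_pos by (simp add: power_divide)
    moreover have "delay (l + 1 + m1) trunc_geom n = p ^ (n - (l + 1 + m1)) *
        of_bool (int l + int m1 + 1 \<le> int n \<and> int n \<le> int l + int m1 + int m2)"
      using True by (auto simp: delay_def trunc_geom_def of_bool_def)
    ultimately show ?thesis by (simp only: mult.assoc[symmetric])
  next
    case False
    then show ?thesis by (simp add: delay_def)
  qed
  show ?thesis unfolding 1 2 pw by (simp add: algebra_simps)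
qed

lemma trunc_geom_moment_terms:
  "(\<Sum>n<m2. p ^ n * real (n + (l + 1)) ^ j) - q ^ m1 * (\<Sum>n<m2. p ^ n * real (n + (l + 1 + m1)) ^ j) =
    (\<Sum>k = l + 1..l + m2. real k ^ j * p ^ (k - l - 1))
     - (q / p) ^ m1 * (\<Sum>k = l + m1 + 1..l + m1 + m2. real k ^ j * p ^ (k - l - 1))"
proof -
  have shift: "(\<Sum>k = c + 1..c + m2. h k) = (\<Sum>n<m2. h (n + (c + 1)))" for c and h :: "nat \<Rightarrow> real"
    by (rule sum.reindex_bij_witness[where i = "\<lambda>n. n + (c + 1)" and j = "\<lambda>k. k - (c + 1)"]) auto
  have pq: "q ^ m1 * (p ^ n * x) = (q / p) ^ m1 * (x * p ^ (n + m1))" for n x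
    using p_pos by (simp add: power_add power_divide)
  have "(\<Sum>n<m2. p ^ n * real (n + (l + 1)) ^ j) = (\<Sum>k = l + 1..l + m2. real k ^ j * p ^ (k - l - 1))"
    unfolding shift by (intro sum.cong refl) (simp add: mult.commute)
  moreover have "q ^ m1 * (\<Sum>n<m2. p ^ n * real (n + (l + 1 + m1)) ^ j) =
      (q / p) ^ m1 * (\<Sum>k = l + m1 + 1..l + m1 + m2. real k ^ j * p ^ (k - l - 1))"
    unfolding shift sum_distrib_left
  proof (intro sum.cong refl)
    fix n
    have "n + (l + m1 + 1) - l - 1 = n + m1" "n + (l + m1 + 1) = n + (l + 1 + m1)" by simp_all
    then show "q ^ m1 * (p ^ n * real (n + (l + 1 + m1)) ^ j) =
        (q / p) ^ m1 * (real (n + (l + m1 + 1)) ^ j * p ^ (n + (l + m1 + 1) - l - 1))"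
      by (simp only: pq)
  qed
  ultimately show ?thesis by (simp only:)
qed

end

section \<open>Transfer to the waiting times of the trials\<close>

theorem theorem2p9:
  fixes M :: "'a measure"
    and \<zeta> :: "nat \<Rightarrow> 'a \<Rightarrow> nat"
    and p q a :: real
    and l1 k1 l2 k2 l m1 m2 :: nat
    and \<rho> :: "nat \<Rightarrow> 'a \<Rightarrow> enat"
    and H :: "nat \<Rightarrow> complex \<Rightarrow> complex"
    and g :: "nat \<Rightarrow> int \<Rightarrow> real"
    and \<mu> :: "nat \<Rightarrow> nat \<Rightarrow> real"
  assumes "prob_space M"
    and "prob_space.indep_vars M (\<lambda>_. count_space UNIV) \<zeta> {1..}"
    and "\<And>i. 1 \<le> i \<Longrightarrow> measure M {\<omega> \<in> space M. \<zeta> i \<omega> = 1} = p"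
    and "\<And>i. 1 \<le> i \<Longrightarrow> measure M {\<omega> \<in> space M. \<zeta> i \<omega> = 0} = q"
    and "0 < p" and "p < 1" and "q = 1 - p"
    and "1 \<le> l1" and "l1 \<le> k1" and "1 \<le> l2" and "l2 \<le> k2"
    and "a = q ^ l1 * p ^ l2"
    and "l = l1 + l2" and "m1 = k1 - l1 + 1" and "m2 = k2 - l2 + 1"
    and "\<rho> = (\<lambda>r \<omega>. waiting_time l1 k1 l2 k2 r (\<lambda>i. \<zeta> i \<omega>))"
    and "H = (\<lambda>r t. pgf M (\<rho> r) t)"
    and "g = (\<lambda>r m. point_prob M (\<rho> r) m)"
    and "\<mu> = (\<lambda>r j. enn2real (moment M (\<rho> r) j))"
  shows
    "(\<forall>r\<ge>1. \<forall>t. norm t \<le> 1 \<longrightarrow>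
        H r t = of_real q * t / (1 - of_real p * t) *
          (of_real a * t ^ l * (1 - (of_real q * t) ^ m1) * (1 - (of_real p * t) ^ m2) /
           (1 - t + of_real a * t ^ l * (1 - (of_real q * t) ^ m1) * (1 - (of_real p * t) ^ m2))) ^ r)
   \<and> (\<forall>r\<ge>2. \<forall>m\<ge>int l * int r + 1.
        g r m = g r (m - 1) + a *
          (g (r - 1) (m - int l) - g r (m - int l)
           - q ^ m1 * (g (r - 1) (m - int l - int m1) - g r (m - int l - int m1))
           - p ^ m2 * (g (r - 1) (m - int l - int m2) - g r (m - int l - int m2))
           + q ^ m1 * p ^ m2 *
               (g (r - 1) (m - int l - int m1 - int m2) - g r (m - int l - int m1 - int m2))))
   \<and> (\<forall>m\<ge>int l + 1.
        g 1 m = g 1 (m - 1)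
          + q * a * p powi (m - int l - 1) *
              (of_bool (int l + 1 \<le> m \<and> m \<le> int l + int m2)
               - (q / p) ^ m1 *
                   of_bool (int l + int m1 + 1 \<le> m \<and> m \<le> int l + int m1 + int m2))
          - a * (g 1 (m - int l) - q ^ m1 * g 1 (m - int l - int m1)
                 - p ^ m2 * g 1 (m - int l - int m2)
                 + q ^ m1 * p ^ m2 * g 1 (m - int l - int m1 - int m2)))
   \<and> (\<forall>m. g 0 m = of_bool (m = 0))
   \<and> (\<forall>r\<ge>1. \<forall>m. m \<le> int l * int r \<longrightarrow> g r m = 0)
   \<and> (\<forall>r j. moment M (\<rho> r) j < \<infinity>)
   \<and> (\<forall>j\<ge>1. \<forall>r\<ge>2.
        \<mu> r j = (\<Sum>k\<le>j. real (j choose k) *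
          (\<mu> r k + a *
             (real l ^ (j - k) - q ^ m1 * real (l + m1) ^ (j - k)
              - p ^ m2 * real (l + m2) ^ (j - k)
              + q ^ m1 * p ^ m2 * real (l + m1 + m2) ^ (j - k)) *
             (\<mu> (r - 1) k - \<mu> r k))))
   \<and> (\<forall>i. \<mu> 0 i = of_bool (i = 0))
   \<and> (\<forall>j\<ge>1.
        \<mu> 1 j = (\<Sum>k\<le>j. real (j choose k) * \<mu> 1 k *
            (1 - a *
              (real l ^ (j - k) - q ^ m1 * real (l + m1) ^ (j - k)
               - p ^ m2 * real (l + m2) ^ (j - k)
               + q ^ m1 * p ^ m2 * real (l + m1 + m2) ^ (j - k))))
          + q * a *
            ((\<Sum>k = l + 1..l + m2. real k ^ j * p ^ (k - l - 1))
             - (q / p) ^ m1 *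
               (\<Sum>k = l + m1 + 1..l + m1 + m2. real k ^ j * p ^ (k - l - 1))))"
proof -
  interpret T: pattern_trials M \<zeta> p q l1 k1 l2 k2
    unfolding pattern_trials_def pattern_trials_axioms_def bernoulli_trials_def bernoulli_trials_axioms_def
    using assms(1-11) by blast
  \<comment> \<open>From here on the renewal equations make all the power series results available
    for the trials.\<close>
  interpret D: pattern_distribution p q a l1 k1 l2 k2 l m1 m2 T.start_prob T.wait_prob
  proof
    show "0 \<le> T.wait_prob r n" for r n by (simp add: T.wait_prob_def)
  qed (use assms(5-15) T.start_prob_rec T.wait_prob_Suc T.summable_wait_prob in auto)
  let ?\<rho> = "\<lambda>r \<omega>. waiting_time l1 k1 l2 k2 r (\<lambda>i. \<zeta> i \<omega>)"
  have g: "g r m = (if m < 0 then 0 else T.wait_prob r (nat m))" for r m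
    using T.point_prob_waiting_time assms(16,18) by simp
  \<comment> \<open>Integer shifts may run below zero, where \<open>g\<close> vanishes;
    \<open>delay\<close> encodes just that.\<close>
  have gd: "g r (int n - int c) = delay c (T.wait_prob r) n" for r n c
    using T.point_prob_delay assms(16,18) by simp
  have gd1: "g r (int n - int c - int d) = delay (c + d) (T.wait_prob r) n" for r n c d
    using gd[of r n "c + d"] by (simp add: algebra_simps)
  have gd2: "g r (int n - int c - int d - int e) = delay (c + d + e) (T.wait_prob r) n" for r n c d e
    using gd[of r n "c + d + e"] by (simp add: algebra_simps)
  have gd0: "g r (int n - 1) = delay 1 (T.wait_prob r) n" "g r (int n) = T.wait_prob r n" for r n
    using gd[of r n 1] by (simp_all add: g)
  have H: "H r t = D.gen r t" if "norm t \<le> 1" for r t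
  proof -
    have "(\<lambda>m. of_real (T.wait_prob r m) * t ^ m) sums pgf M (?\<rho> r) t"
      unfolding T.wait_prob_def by (rule T.pgf_sums[OF T.waiting_time_events that])
    from sums_unique2[OF this D.gen_sums[OF that]] show ?thesis unfolding assms(16,17) .
  qed
  \<comment> \<open>The point probabilities sum to 1, so no mass is left at infinity.\<close>
  have fin: "AE \<omega> in M. ?\<rho> r \<omega> \<noteq> \<infinity>" if "1 \<le> r" for r
  proof -
    have "T.prob {\<omega> \<in> space M. ?\<rho> r \<omega> \<noteq> \<infinity>} = 1"
      by (rule sums_unique2[OF T.point_events_sums[OF T.waiting_time_events]], fold T.wait_prob_def)
        (rule D.g_sums_1[OF that])
    from T.AE_prob_1[OF this] show ?thesis by simp
  qed
  have mom: "moment M (\<rho> r) j = ennreal (D.mom r j)" if "1 \<le> r" for r j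
    unfolding assms(16)
    by (rule T.moment_eq_suminf[OF T.waiting_time_events fin[OF that]], fold T.wait_prob_def)
      (rule D.mom_sums[OF that])
  have mom_nonneg: "0 \<le> D.mom r j" if "1 \<le> r" for r j
    by (rule sums_le[OF _ sums_zero D.mom_sums[OF that]]) (simp add: D.g_nonneg)
  have \<mu>: "\<mu> r j = D.mom r j" if "1 \<le> r" for r j
    using mom[OF that] mom_nonneg[OF that] assms(19) by simp
  \<comment> \<open>The waiting time for \<open>r = 0\<close> is constantly 0, and
    \<open>0 ^ 0 = 1\<close> gives the Kronecker delta.\<close>
  have mom0: "moment M (\<rho> 0) j = of_bool (j = 0)" for j
    using assms(16) T.emeasure_space_1
    by (cases j) (simp_all add: moment_def waiting_time_zero[OF assms(8,10)] flip: zero_enat_def)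
  have part_i: "H r t = of_real q * t / (1 - of_real p * t) *
          (of_real a * t ^ l * (1 - (of_real q * t) ^ m1) * (1 - (of_real p * t) ^ m2) /
           (1 - t + of_real a * t ^ l * (1 - (of_real q * t) ^ m1) * (1 - (of_real p * t) ^ m2))) ^ r"
    if "r \<ge> 1" "norm t \<le> 1" for r t
    using D.gen_closed_form[OF that(2,1)] H[OF that(2)] unfolding D.numerc_def by simp
  have rec_Suc: "g r m = g r (m - 1) + a *
          (g (r - 1) (m - int l) - g r (m - int l)
           - q ^ m1 * (g (r - 1) (m - int l - int m1) - g r (m - int l - int m1))
           - p ^ m2 * (g (r - 1) (m - int l - int m2) - g r (m - int l - int m2))
           + q ^ m1 * p ^ m2 *
               (g (r - 1) (m - int l - int m1 - int m2) - g r (m - int l - int m1 - int m2)))"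
    if r: "r \<ge> 2" and m: "m \<ge> int l * int r + 1" for r m
  proof -
    have "0 \<le> int l * int r" by simp
    with m have "0 \<le> m" by linarith
    then obtain n where n: "m = int n" using nonneg_int_cases by blast
    obtain s where s: "r = Suc s" "1 \<le> s" using r by (cases r) auto
    show ?thesis
      unfolding n gd gd0 gd1 gd2 s(1) diff_Suc_1
      unfolding D.g_Suc_rec[OF s(2), of n] by (simp add: algebra_simps)
  qed
  have rec_1: "g 1 m = g 1 (m - 1)
          + q * a * p powi (m - int l - 1) *
              (of_bool (int l + 1 \<le> m \<and> m \<le> int l + int m2)
               - (q / p) ^ m1 *
                   of_bool (int l + int m1 + 1 \<le> m \<and> m \<le> int l + int m1 + int m2))
          - a * (g 1 (m - int l) - q ^ m1 * g 1 (m - int l - int m1)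
                 - p ^ m2 * g 1 (m - int l - int m2)
                 + q ^ m1 * p ^ m2 * g 1 (m - int l - int m1 - int m2))"
    if m: "m \<ge> int l + 1" for m
  proof -
    from m have "0 \<le> m" by linarith
    then obtain n where n: "m = int n" using nonneg_int_cases by blast
    then have "l + 1 \<le> n" using m by linarith
    from D.g_1_rec[of n, unfolded D.trunc_geom_delay_terms[OF this]] show ?thesis
      unfolding n gd gd0 gd1 gd2 by (simp only: mult.assoc)
  qed
  have init_0: "g 0 m = of_bool (m = 0)" for m
    by (auto simp: g T.wait_prob_0)
  have init: "g r m = 0" if "r \<ge> 1" "m \<le> int l * int r" for r m
  proof (cases "m < 0")
    case False
    then have "nat m \<le> l * r" using that(2) by (simp add: nat_le_iff)
    then show ?thesis using D.g_zero[OF that(1)] by (simp add: g)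
  qed (simp add: g)
  \<comment> \<open>Without finiteness \<open>\<mu>\<close> would not be faithful, because
    \<open>enn2real\<close> sends infinity to 0.\<close>
  have finite_moment: "moment M (\<rho> r) j < \<infinity>" for r j
    by (cases r) (simp_all add: mom mom0)
  have mom_rec: "\<mu> r j = (\<Sum>k\<le>j. real (j choose k) *
          (\<mu> r k + a *
             (real l ^ (j - k) - q ^ m1 * real (l + m1) ^ (j - k)
              - p ^ m2 * real (l + m2) ^ (j - k)
              + q ^ m1 * p ^ m2 * real (l + m1 + m2) ^ (j - k)) *
             (\<mu> (r - 1) k - \<mu> r k)))" if "r \<ge> 2" for r j
  proof -
    obtain s where s: "r = Suc s" "1 \<le> s" using \<open>r \<ge> 2\<close> by (cases r) auto
    then have "\<mu> r = D.mom (Suc s)" "\<mu> (r - 1) = D.mom s" using \<mu> by auto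
    then show ?thesis using D.mom_Suc[OF s(2), of j] by simp
  qed
  have mom_rec_1: "\<mu> 1 j = (\<Sum>k\<le>j. real (j choose k) * \<mu> 1 k *
            (1 - a *
              (real l ^ (j - k) - q ^ m1 * real (l + m1) ^ (j - k)
               - p ^ m2 * real (l + m2) ^ (j - k)
               + q ^ m1 * p ^ m2 * real (l + m1 + m2) ^ (j - k))))
          + q * a *
            ((\<Sum>k = l + 1..l + m2. real k ^ j * p ^ (k - l - 1))
             - (q / p) ^ m1 *
               (\<Sum>k = l + m1 + 1..l + m1 + m2. real k ^ j * p ^ (k - l - 1)))" for j
    using D.mom_1[of j] unfolding D.trunc_geom_moment_terms \<mu>[OF order_refl] .
  have mom_init: "\<mu> 0 i = of_bool (i = 0)" for i
    using mom0[of i] assms(19) by simp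
  show ?thesis
    using part_i rec_Suc rec_1 init_0 init finite_moment mom_rec mom_init mom_rec_1
    by (intro conjI allI impI) assumption+
qed

end
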